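(* Suppose the target $p(\theta\mid y)$ is $\mathrm{N}(\nu,\Lambda^{-1})$ on $\mathbb{R}^d$ with positive definite precision matrix $\Lambda$. Let the variational approximation $q(\theta)$ be $\mathrm{N}(\mu,\Sigma)$, and let $\hat q(\theta)=\mathrm{N}(\theta\mid\hat\mu,\hat\Sigma)$ be an estimate of $q(\theta)$, where $\Sigma$ and $\hat\Sigma$ are both diagonal (positive definite) matrices. Let $\hat S_q(\lambda)$ and $\hat F_q(\lambda)$, $\lambda=(\mu,\Sigma)$, be the batch approximated score-based and Fisher divergences computed from $B$ i.i.d. samples from $\hat q$. As $B\to\infty$, $\hat S_q(\lambda)$ and $\hat F_q(\lambda)$ are minimized at $(\mu^{\hat S},\Sigma^{\hat S})$ and $(\mu^{\hat F},\Sigma^{\hat F})$ respectively, where, for $i=1,\dots,d$, $$\Sigma^{\hat S}_{ii}\xrightarrow{\text{a.s.}}\sqrt{\frac{\hat\Sigma_{ii}}{\sum_{j=1}^d\hat\Sigma_{jj}\Lambda_{ij}^2}},\qquad \Sigma^{\hat F}_{ii}\xrightarrow{\text{a.s.}}\frac{1}{\Lambda_{ii}},$$ $$\mu^{\hat S}_i\xrightarrow{\text{a.s.}}\hat\mu_i+\sqrt{\frac{\hat\Sigma_{ii}}{\sum_{j=1}^d\hat\Sigma_{jj}\Lambda_{ij}^2}}\;\sum_{j=1}^d\Lambda_{ij}(\nu_j-\hat\mu_j),$$ $$\mu^{\hat F}_i\xrightarrow{\text{a.s.}}\hat\mu_i+\frac{1}{\Lambda_{ii}}\sum_{j=1}^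d\Lambda_{ij}(\nu_j-\hat\mu_j).$$
   Context: Let $\theta_1,\theta_2,\dots$ be i.i.d. from $\hat q$, and let $g_h(\theta)=\nabla_\theta\log p(\theta\mid y)=-\Lambda(\theta-\nu)$. Using the first $B>1$ samples, $$\hat S_q(\lambda)=\frac1B\sum_{i=1}^B\|g_h(\theta_i)+\Sigma^{-1}(\theta_i-\mu)\|_\Sigma^2,\qquad \hat F_q(\lambda)=\frac1B\sum_{i=1}^B\|g_h(\theta_i)+\Sigma^{-1}(\theta_i-\mu)\|^2,$$ where $\|z\|_\Sigma^2=z^\top\Sigma z$ and $\|\cdot\|$ is the Euclidean norm. They are minimized over $\mu\in\mathbb{R}^d$ and diagonal matrices $\Sigma$ with positive diagonal entries, with the samples held fixed; the minimizers depend on $B$ and on the samples. The minimizer of $\hat F_q$ exists when all diagonal entries of $\frac1B\sum_{i}(\theta_i-\bar\theta)(g_h(\theta_i)-\bar g_h)^\top$ are negative (bars denoting sample averages), which almost surely is the case for all sufficiently large $B$. *)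

theory Defs
  imports "HOL-Probability.Probability"
begin

definition pos_definite :: "real^'n^'n \<Rightarrow> bool" where
  "pos_definite A \<longleftrightarrow> transpose A = A \<and> (\<forall>x. x \<noteq> 0 \<longrightarrow> 0 < x \<bullet> (A *v x))"

definition pos_diagonal :: "real^'n^'n \<Rightarrow> bool" where
  "pos_diagonal A \<longleftrightarrow> (\<forall>i j. i \<noteq> j \<longrightarrow> A $ i $ j = 0) \<and> (\<forall>i. 0 < A $ i $ i)"

text \<open>Lebesgue density of the multivariate normal distribution with mean \<open>m\<close> and
  covariance (not precision) matrix \<open>S\<close>.\<close>

definition mvn_density :: "real^'n \<Rightarrow> real^'n^'n \<Rightarrow> real^'n \<Rightarrow> real" where
  "mvn_density m S x =
     exp (- ((x - m) \<bullet> (matrix_inv S *v (x - m))) / 2) / sqrt ((2 * pi) ^ CARD('n) * det S)"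

definition score :: "(real^'n \<Rightarrow> real) \<Rightarrow> real^'n \<Rightarrow> real^'n" where
  "score p x = (THE D. GDERIV (\<lambda>t. ln (p t)) x :> D)"

text \<open>In the two batch divergences, \<open>g\<close> is the score of the target, \<open>t 0, t 1, \<dots>\<close> are the
  realized sample points, of which the first \<open>B\<close> are used, and the last argument is the
  variational parameter (mean, covariance). The score of the normal density with that
  parameter at \<open>x\<close> is \<open>- matrix_inv S *v (x - m)\<close>, which explains the plus sign.\<close>

definition batch_score_div ::
  "(real^'n \<Rightarrow> real^'n) \<Rightarrow> nat \<Rightarrow> (nat \<Rightarrow> real^'n) \<Rightarrow> (real^'n) \<times> (real^'n^'n) \<Rightarrow> real" where
  "batch_score_div g B t = (\<lambda>(m, S).
     (1 / real B) * (\<Sum>i<B. let z = g (t i) + matrix_inv S *v (t i - m) in z \<bullet> (S *v z)))"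

definition batch_fisher_div ::
  "(real^'n \<Rightarrow> real^'n) \<Rightarrow> nat \<Rightarrow> (nat \<Rightarrow> real^'n) \<Rightarrow> (real^'n) \<times> (real^'n^'n) \<Rightarrow> real" where
  "batch_fisher_div g B t = (\<lambda>(m, S).
     (1 / real B) * (\<Sum>i<B. (norm (g (t i) + matrix_inv S *v (t i - m)))\<^sup>2))"

definition is_minimizer :: "((real^'n) \<times> (real^'n^'n) \<Rightarrow> real) \<Rightarrow> (real^'n) \<times> (real^'n^'n) \<Rightarrow> bool" where
  "is_minimizer D l \<longleftrightarrow> is_arg_min D (\<lambda>(m, S). pos_diagonal S) l"

end

theory Submission
  imports Defs
begin

text \<open>For diagonal \<open>\<Sigma>\<close> both batch divergences are sums over the coordinates. Writing \<open>x\<close> for the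
  \<open>i\<close>-th coordinate of the samples and \<open>y\<close> for that of their scores, with sample means
  \<open>E x\<close>, \<open>E y\<close> and sample covariances \<open>C x x\<close>, \<open>C x y\<close>, \<open>C y y\<close>, the Fisher summand at mean \<open>m\<close> and
  variance \<open>s\<close> is \<open>C y y + 2 C x y / s + C x x / s\<^sup>2 + (E y + (E x - m) / s)\<^sup>2\<close>, and the score-based
  summand is \<open>s\<close> times this. Completing squares, both are uniquely minimized at \<open>m = E x + s E y\<close>, with
  \<open>s = - C x x / C x y\<close> for the Fisher and \<open>s = sqrt (C x x / C y y)\<close> for the score-based divergence. Since \<open>y\<close> is
  affine in the sample, the limits follow from the strong law for the coordinates and their pairwise products;
  as Gaussians have moments of all orders, it is enough to have the strong law under a fourth
  moment bound, where the expectation of \<open>(S\<^sub>n / n)\<^sup>4\<close> is \<open>O(1 / n\<^sup>2)\<close>, hence summable. For \<open>B > 1\<close> the sample variances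
  are positive because two independent samples almost surely differ in every nontrivial linear
  functional.\<close>

section \<open>A strong law of large numbers under fourth moments\<close>

text \<open>Monotone convergence exchanges sum and integral, so the series of the \<open>Z n\<close>
  has finite expectation. It is therefore almost surely finite, and the terms of a convergent series
  vanish.\<close>

lemma AE_tendsto_zero_of_summable_integral:
  fixes Z :: "nat \<Rightarrow> 'a \<Rightarrow> real"
  assumes int: "\<And>n. integrable M (Z n)" and nn: "\<And>n x. 0 \<le> Z n x"
    and sm: "summable (\<lambda>n. \<integral>x. Z n x \<partial>M)"
  shows "AE x in M. (\<lambda>n. Z n x) \<longlonglongrightarrow> 0"
proof -
  have [measurable]: "Z n \<in> borel_measurable M" for n
    using int by auto
  have "(\<integral>\<^sup>+x. (\<Sum>n. ennreal (Z n x)) \<partial>M) = (\<Sum>n. \<integral>\<^sup>+x. ennreal (Z n x) \<partial>M)"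
    by (rule nn_integral_suminf) simp
  also have "\<dots> = (\<Sum>n. ennreal (\<integral>x. Z n x \<partial>M))"
    by (simp add: nn_integral_eq_integral int nn)
  also have "\<dots> = ennreal (\<Sum>n. \<integral>x. Z n x \<partial>M)"
    by (rule suminf_ennreal2) (auto simp: nn sm)
  finally have "(\<integral>\<^sup>+x. (\<Sum>n. ennreal (Z n x)) \<partial>M) \<noteq> \<infinity>"
    by simp
  then have "AE x in M. (\<Sum>n. ennreal (Z n x)) \<noteq> \<infinity>"
    by (intro nn_integral_noteq_infinite) simp_all
  then show ?thesis
  proof (rule AE_mp, intro AE_I2 impI)
    fix x assume "(\<Sum>n. ennreal (Z n x)) \<noteq> \<infinity>"
    then have "summable (\<lambda>n. Z n x)"
      by (intro summable_suminf_not_top) (auto simp: nn)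
    then show "(\<lambda>n. Z n x) \<longlonglongrightarrow> 0"
      by (rule summable_LIMSEQ_zero)
  qed
qed

lemma abs_power_le_one_add_power4:
  fixes x :: real
  assumes "p \<le> 4"
  shows "\<bar>x\<bar> ^ p \<le> 1 + x ^ 4"
proof (cases "\<bar>x\<bar> \<le> 1")
  case True
  then have "\<bar>x\<bar> ^ p \<le> 1" by (simp add: power_le_one)
  then show ?thesis by (smt (verit) zero_le_even_power even_numeral)
next
  case False
  then have "\<bar>x\<bar> ^ p \<le> \<bar>x\<bar> ^ 4" using assms by (intro power_increasing) auto
  then show ?thesis by (simp add: power_even_abs)
qed

context prob_space
begin

lemma integrable_power_of_power4:
  fixes X :: "'a \<Rightarrow> real"
  assumes [measurable]: "X \<in> borel_measurable M" and "integrable M (\<lambda>x. X x ^ 4)" and "p \<le> 4"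
  shows "integrable M (\<lambda>x. X x ^ p)"
proof (rule Bochner_Integration.integrable_bound)
  show "integrable M (\<lambda>x. 1 + X x ^ 4)" using assms by simp
  show "AE x in M. norm (X x ^ p) \<le> norm (1 + X x ^ 4)"
    using abs_power_le_one_add_power4[OF \<open>p \<le> 4\<close>]
    by (intro AE_I2) (simp add: power_abs abs_of_nonneg)
qed simp

text \<open>Induction on \<open>n\<close>, expanding the fourth power of \<open>S n + X n\<close>.
  By independence the mixed terms of odd degree have expectation zero, since each contains a
  mean-zero factor to the first power. What remains grows linearly in \<open>n\<close>, so the total
  is quadratic.\<close>

lemma
  fixes X :: "nat \<Rightarrow> 'a \<Rightarrow> real"
  assumes indep: "indep_vars (\<lambda>_. borel) X UNIV"
    and int4: "\<And>k. integrable M (\<lambda>x. X k x ^ 4)"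
    and mean0: "\<And>k. expectation (X k) = 0"
    and bound: "\<And>k. expectation (\<lambda>x. X k x ^ 4) \<le> K"
  shows integrable_sum_power4: "integrable M (\<lambda>x. (\<Sum>k<n. X k x) ^ 4)"
    and expectation_sum_power4_le:
      "expectation (\<lambda>x. (\<Sum>k<n. X k x) ^ 4) \<le> (K + 3 * (1 + K)\<^sup>2) * (real n)\<^sup>2"
proof -
  have [measurable]: "X k \<in> borel_measurable M" for k
    using indep by (auto simp: indep_vars_def)
  define S where "S n x = (\<Sum>k<n. X k x)" for n x
  have S_Suc: "S (Suc n) x = S n x + X n x" for n x
    by (simp add: S_def)
  have [measurable]: "S n \<in> borel_measurable M" for n
    unfolding S_def[abs_def] by measurable
  have intX: "p \<le> 4 \<Longrightarrow> integrable M (\<lambda>x. X k x ^ p)" for p k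
    by (rule integrable_power_of_power4) (auto simp: int4)
  have K0: "0 \<le> K"
    using bound[of 0] by (smt (verit) integral_nonneg_AE AE_I2 zero_le_even_power even_numeral)
  have X2: "expectation (\<lambda>x. X k x ^ 2) \<le> 1 + K" for k
  proof -
    have "expectation (\<lambda>x. X k x ^ 2) \<le> expectation (\<lambda>x. 1 + X k x ^ 4)"
      using abs_power_le_one_add_power4[of 2] intX by (intro integral_mono) (auto simp: power_even_abs)
    also have "\<dots> \<le> 1 + K" using bound[of k] int4[of k] by (simp add: prob_space)
    finally show ?thesis .
  qed
  have indepS: "indep_var borel (\<lambda>x. X n x ^ q) borel (\<lambda>x. S n x ^ p)" for n p q
  proof -
    have "indep_var borel (X n) borel (S n)"
      using indep_vars_sum[of "{..<n}" n X] indep_vars_subset[OF indep, of "insert n {..<n}"]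
      by (simp add: S_def[abs_def])
    from indep_var_compose[OF this, of "\<lambda>t. t ^ q" borel "\<lambda>t. t ^ p" borel]
    show ?thesis by (simp add: comp_def)
  qed
  \<comment> \<open>The three claims go through the induction together: integrability allows the
    expectation to be split, and the second-moment bound controls the only surviving mixed
    term.\<close>
  have main: "integrable M (\<lambda>x. S n x ^ 4) \<and> expectation (\<lambda>x. S n x ^ 2) \<le> real n * (1 + K) \<and>
      expectation (\<lambda>x. S n x ^ 4) \<le> (K + 3 * (1 + K)\<^sup>2) * (real n)\<^sup>2"
  proof (induction n)
    case 0
    then show ?case by (simp add: S_def)
  next
    case (Suc n)
    have intS: "p \<le> 4 \<Longrightarrow> integrable M (\<lambda>x. S n x ^ p)" for p
      by (rule integrable_power_of_power4) (use Suc.IH in auto)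
    have prod_int: "integrable M (\<lambda>x. X n x ^ q * S n x ^ p)"
      and prod_eq: "expectation (\<lambda>x. X n x ^ q * S n x ^ p) =
        expectation (\<lambda>x. X n x ^ q) * expectation (\<lambda>x. S n x ^ p)" if "p \<le> 4" "q \<le> 4" for p q
      using indep_var_integrable[OF indepS intX intS] indep_var_lebesgue_integral[OF indepS intX intS] that
      by auto
    \<comment> \<open>The exponents 1 are written out so that every mixed term has the shape
      required by \<open>prod_int\<close> and \<open>prod_eq\<close>.\<close>
    have e4: "S (Suc n) x ^ 4 = S n x ^ 4 + 4 * (X n x ^ 1 * S n x ^ 3)
        + 6 * (X n x ^ 2 * S n x ^ 2) + 4 * (X n x ^ 3 * S n x ^ 1) + X n x ^ 4" for x
      unfolding S_Suc by (simp add: eval_nat_numeral algebra_simps)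
    have e2: "S (Suc n) x ^ 2 = S n x ^ 2 + 2 * (X n x ^ 1 * S n x ^ 1) + X n x ^ 2" for x
      unfolding S_Suc by (simp add: eval_nat_numeral algebra_simps)
    have S0: "expectation (S n) = 0"
      unfolding S_def[abs_def] using mean0 intX[of 1] by simp
    have i4: "integrable M (\<lambda>x. S (Suc n) x ^ 4)"
      unfolding e4 by (intro Bochner_Integration.integrable_add integrable_mult_right prod_int intS intX) auto
    have E2: "expectation (\<lambda>x. S (Suc n) x ^ 2) = expectation (\<lambda>x. S n x ^ 2) + expectation (\<lambda>x. X n x ^ 2)"
      unfolding e2
      using prod_int[of 1 1] prod_eq[of 1 1] intS[of 2] intX[of 2] mean0[of n] by simp
    have E4: "expectation (\<lambda>x. S (Suc n) x ^ 4) = expectation (\<lambda>x. S n x ^ 4)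
      + 6 * (expectation (\<lambda>x. X n x ^ 2) * expectation (\<lambda>x. S n x ^ 2)) + expectation (\<lambda>x. X n x ^ 4)"
      unfolding e4
      using prod_int[of 3 1] prod_int[of 1 3] prod_int[of 2 2] prod_eq[of 1 3] prod_eq[of 3 1] prod_eq[of 2 2] 
        intS[of 4] intX[of 4] mean0[of n] S0 by simp
    have "expectation (\<lambda>x. X n x ^ 2) * expectation (\<lambda>x. S n x ^ 2) \<le> (1 + K) * (real n * (1 + K))"
      using Suc X2[of n] K0 by (intro mult_mono) auto
    then have "expectation (\<lambda>x. S (Suc n) x ^ 4)
        \<le> (K + 3 * (1 + K)\<^sup>2) * (real n)\<^sup>2 + 6 * ((1 + K) * (real n * (1 + K))) + K"
      unfolding E4 using Suc bound[of n] by linarith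
    also have "\<dots> \<le> (K + 3 * (1 + K)\<^sup>2) * (real (Suc n))\<^sup>2"
    proof -
      \<comment> \<open>This is what is left of \<open>(K + 3 * (1 + K)^2) * (2 * n + 1)\<close>,
        the increment of the bound from \<open>n\<close> to \<open>n + 1\<close>, after subtracting
        \<open>6 * (1 + K)^2 * n + K\<close>. The factor 3 is chosen so that the terms
        \<open>6 * (1 + K)^2 * n\<close> cancel.\<close>
      have "0 \<le> 2 * K * real n + 3 * (1 + K)\<^sup>2" using K0 by simp
      then show ?thesis by (simp add: power2_eq_square algebra_simps)
    qed
    finally show ?case
      using i4 E2 Suc X2[of n] by (auto simp: algebra_simps)
  qed
  from main show "integrable M (\<lambda>x. (\<Sum>k<n. X k x) ^ 4)"
    "expectation (\<lambda>x. (\<Sum>k<n. X k x) ^ 4) \<le> (K + 3 * (1 + K)\<^sup>2) * (real n)\<^sup>2"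
    by (auto simp: S_def)
qed

text \<open>After centring, the fourth moment of the average is at most \<open>C / n^2\<close>. This
  is summable, so the fourth powers of the averages tend to zero almost surely.\<close>

lemma strong_law_power4:
  fixes X :: "nat \<Rightarrow> 'a \<Rightarrow> real"
  assumes indep: "indep_vars (\<lambda>_. borel) X UNIV"
    and int4: "\<And>k. integrable M (\<lambda>x. X k x ^ 4)"
    and mean: "\<And>k. expectation (X k) = c"
    and bound: "\<And>k. expectation (\<lambda>x. (X k x - c) ^ 4) \<le> K"
  shows "AE x in M. (\<lambda>n. (1 / real n) * (\<Sum>k<n. X k x)) \<longlonglongrightarrow> c"
proof -
  have [measurable]: "X k \<in> borel_measurable M" for k
    using indep by (auto simp: indep_vars_def)
  have intX: "p \<le> 4 \<Longrightarrow> integrable M (\<lambda>x. X k x ^ p)" for p k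
    by (rule integrable_power_of_power4) (auto simp: int4)
  define Y where "Y k x = X k x - c" for k x
  have indepY: "indep_vars (\<lambda>_. borel) Y UNIV"
    unfolding Y_def[abs_def] by (rule indep_vars_compose2[OF indep]) simp
  have int4Y: "integrable M (\<lambda>x. Y k x ^ 4)" for k
  proof -
    have "Y k x ^ 4 = X k x ^ 4 - 4 * c * X k x ^ 3 + 6 * c^2 * X k x ^ 2 - 4 * c^3 * X k x ^ 1 + c^4" for x
      unfolding Y_def by (simp add: eval_nat_numeral algebra_simps)
    then show ?thesis
      using intX[of 4 k] intX[of 3 k] intX[of 2 k] intX[of 1 k] by simp
  qed
  have meanY: "expectation (Y k) = 0" for k
    unfolding Y_def[abs_def] using intX[of 1 k] mean[of k] by (simp add: prob_space)
  have boundY: "expectation (\<lambda>x. Y k x ^ 4) \<le> K" for k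
    using bound by (simp add: Y_def)
  define C where "C = K + 3 * (1 + K)\<^sup>2"
  define Z where "Z n x = ((1 / real n) * (\<Sum>k<n. Y k x)) ^ 4" for n x
  have "AE x in M. (\<lambda>n. Z n x) \<longlonglongrightarrow> 0"
  proof (rule AE_tendsto_zero_of_summable_integral)
    show intZ: "integrable M (Z n)" for n
      unfolding Z_def[abs_def] power_mult_distrib
      by (intro integrable_mult_right integrable_sum_power4[OF indepY int4Y meanY boundY])
    show "0 \<le> Z n x" for n x by (simp add: Z_def)
    show "summable (\<lambda>n. expectation (Z n))"
    proof (rule summable_comparison_test')
      show "summable (\<lambda>n. C * inverse (real n ^ 2))"
        by (intro summable_mult inverse_power_summable) simp
      fix n :: nat assume "1 \<le> n"
      have "expectation (Z n) = (1 / real n) ^ 4 * expectation (\<lambda>x. (\<Sum>k<n. Y k x) ^ 4)"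
        unfolding Z_def[abs_def] power_mult_distrib by simp
      also have "\<dots> \<le> (1 / real n) ^ 4 * (C * (real n)\<^sup>2)"
        unfolding C_def
        by (intro mult_left_mono expectation_sum_power4_le[OF indepY int4Y meanY boundY]) simp
      also have "\<dots> = C * inverse (real n ^ 2)"
        using \<open>1 \<le> n\<close> by (simp add: eval_nat_numeral field_simps)
      finally have "expectation (Z n) \<le> C * inverse (real n ^ 2)" .
      moreover have "0 \<le> expectation (Z n)"
        by (rule Bochner_Integration.integral_nonneg) (simp add: Z_def)
      ultimately show "norm (expectation (Z n)) \<le> C * inverse (real n ^ 2)" by simp
    qed
  qed
  then show ?thesis
  proof (rule AE_mp, intro AE_I2 impI)
    fix x assume "(\<lambda>n. Z n x) \<longlonglongrightarrow> 0"
    then have "(\<lambda>n. root 4 (Z n x)) \<longlonglongrightarrow> root 4 0"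
      by (rule tendsto_real_root)
    moreover have "root 4 (y ^ 4) = \<bar>y\<bar>" for y :: real
      using root_abs_power[of 4 y] by (simp add: power_abs)
    ultimately have "(\<lambda>n. \<bar>(1 / real n) * (\<Sum>k<n. Y k x)\<bar>) \<longlonglongrightarrow> 0"
      unfolding Z_def by (simp only: real_root_zero)
    then have "(\<lambda>n. (1 / real n) * (\<Sum>k<n. Y k x)) \<longlonglongrightarrow> 0"
      by (rule tendsto_rabs_zero_cancel)
    then have "(\<lambda>n. (1 / real n) * (\<Sum>k<n. Y k x) + c) \<longlonglongrightarrow> 0 + c"
      by (intro tendsto_intros)
    \<comment> \<open>This fails at \<open>n = 0\<close> unless \<open>c = 0\<close>: there both
      averages are 0 by the convention for division by zero.\<close>
    moreover have "\<forall>\<^sub>F n in sequentially. (1 / real n) * (\<Sum>k<n. Y k x) + c = (1 / real n) * (\<Sum>k<n. X k x)"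
      using eventually_gt_at_top[of 0]
      by eventually_elim (simp add: Y_def sum_subtractf field_simps)
    ultimately show "(\<lambda>n. (1 / real n) * (\<Sum>k<n. X k x)) \<longlonglongrightarrow> c"
      using tendsto_cong by fastforce
  qed
qed

text \<open>Independence makes the joint law a product, so Fubini applies to the diagonal: for each
  fixed value \<open>u\<close> of \<open>U\<close>, the variable \<open>V\<close> hits
  \<open>u\<close> with probability zero.\<close>

lemma AE_indep_var_neq:
  fixes U V :: "'a \<Rightarrow> real"
  assumes indep: "indep_var borel U borel V" and atomless: "\<And>t. AE x in M. V x \<noteq> t"
  shows "AE x in M. U x \<noteq> V x"
proof -
  have [measurable]: "U \<in> borel_measurable M" "V \<in> borel_measurable M"
    and eq: "distr M borel U \<Otimes>\<^sub>M distr M borel V = distr M (borel \<Otimes>\<^sub>M borel) (\<lambda>x. (U x, V x))"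
    using indep by (auto simp: indep_var_distribution_eq)
  interpret U: prob_space "distr M borel U" by (rule prob_space_distr) simp
  interpret V: prob_space "distr M borel V" by (rule prob_space_distr) simp
  interpret UV: pair_prob_space "distr M borel U" "distr M borel V" ..
  have "AE p in distr M borel U \<Otimes>\<^sub>M distr M borel V. fst p \<noteq> snd p"
  proof (rule UV.AE_pair_measure)
    show "{p \<in> space (distr M borel U \<Otimes>\<^sub>M distr M borel V). fst p \<noteq> snd p}
        \<in> sets (distr M borel U \<Otimes>\<^sub>M distr M borel V)"
      by measurable
    show "AE u in distr M borel U. AE v in distr M borel V. fst (u, v) \<noteq> snd (u, v)"
      using atomless by (auto simp: AE_distr_iff eq_commute)
  qed
  then have "AE p in distr M (borel \<Otimes>\<^sub>M borel) (\<lambda>x. (U x, V x)). fst p \<noteq> snd p"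
    unfolding eq .
  then show ?thesis by (subst (asm) AE_distr_iff) auto
qed

end

section \<open>Gaussian densities with diagonal covariance\<close>

text \<open>Lebesgue measure on a Euclidean space is the image of the product of one-dimensional
  Lebesgue measures over the basis, which reduces both claims to Fubini for finite products.\<close>

lemma
  fixes f :: "'b::euclidean_space \<Rightarrow> real \<Rightarrow> real"
  assumes int: "\<And>b. b \<in> Basis \<Longrightarrow> integrable lborel (f b)"
  shows integrable_lborel_prod: "integrable lborel (\<lambda>x. \<Prod>b\<in>Basis. f b (x \<bullet> b))"
    and integral_lborel_prod:
      "(\<integral>x. (\<Prod>b\<in>Basis. f b (x \<bullet> b)) \<partial>lborel) = (\<Prod>b\<in>Basis. \<integral>x. f b x \<partial>lborel)"
proof -
  interpret product_sigma_finite "\<lambda>_::'b. lborel :: real measure" ..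
  have [measurable]: "b \<in> Basis \<Longrightarrow> f b \<in> borel_measurable borel" for b
    using int[of b] by (simp add: integrable_iff_bounded)
  have coord: "(\<Sum>c\<in>Basis. y c *\<^sub>R c) \<bullet> b = y b" if "b \<in> Basis" for y and b :: 'b
    using that by simp
  have [measurable]: "(\<lambda>x. \<Prod>b\<in>Basis. f b (x \<bullet> b)) \<in> borel_measurable borel"
    by measurable
  show "integrable lborel (\<lambda>x. \<Prod>b\<in>Basis. f b (x \<bullet> b))"
    using product_integrable_prod[of Basis f] int
    by (subst lborel_eq, subst integrable_distr_eq) (simp_all add: coord cong: prod.cong)
  show "(\<integral>x. (\<Prod>b\<in>Basis. f b (x \<bullet> b)) \<partial>lborel) = (\<Prod>b\<in>Basis. \<integral>x. f b x \<partial>lborel)"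
    using product_integral_prod[of Basis f] int
    by (subst lborel_eq, subst integral_distr) (simp_all add: coord cong: prod.cong)
qed

lemma prod_Basis_vec:
  "(\<Prod>b\<in>(Basis :: (real^'n) set). h b) = (\<Prod>i\<in>UNIV. h (axis i 1))"
proof -
  have eq: "(Basis :: (real^'n) set) = range (\<lambda>i. axis i 1)"
    by (auto simp: Basis_vec_def)
  have "inj (\<lambda>i::'n. axis i (1::real))" by (auto simp: inj_on_def axis_eq_axis)
  then show ?thesis unfolding eq by (subst prod.reindex) auto
qed

lemma
  fixes f :: "'n::finite \<Rightarrow> real \<Rightarrow> real"
  assumes int: "\<And>i. integrable lborel (f i)"
  shows integrable_lborel_prod_vec: "integrable lborel (\<lambda>x::real^'n. \<Prod>i\<in>UNIV. f i (x $ i))"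
    and integral_lborel_prod_vec:
      "(\<integral>x. (\<Prod>i\<in>UNIV. f i (x $ i)) \<partial>(lborel :: (real^'n) measure)) = (\<Prod>i\<in>UNIV. \<integral>x. f i x \<partial>lborel)"
proof -
  \<comment> \<open>The factors are reindexed by basis vectors. The choice is harmless on the basis,
    because \<open>axis i 1\<close> determines \<open>i\<close>.\<close>
  define F where "F b = f (SOME i. b = axis i (1::real))" for b :: "real^'n"
  have F: "F (axis i 1) = f i" for i
    by (auto simp: F_def axis_eq_axis)
  have intF: "b \<in> Basis \<Longrightarrow> integrable lborel (F b)" for b
    using int by (auto simp: F_def)
  show "integrable lborel (\<lambda>x::real^'n. \<Prod>i\<in>UNIV. f i (x $ i))"
    using integrable_lborel_prod[of F] intF
    by (simp add: prod_Basis_vec F cart_eq_inner_axis)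
  show "(\<integral>x. (\<Prod>i\<in>UNIV. f i (x $ i)) \<partial>(lborel :: (real^'n) measure)) = (\<Prod>i\<in>UNIV. \<integral>x. f i x \<partial>lborel)"
    using integral_lborel_prod[of F] intF
    by (simp add: prod_Basis_vec F cart_eq_inner_axis)
qed

section \<open>Diagonal matrices, and Gaussian densities and moments for diagonal covariance\<close>

lemma matrix_inv_eqI:
  fixes A B :: "real^'n^'n"
  assumes AB: "A ** B = mat 1"
  shows "matrix_inv A = B"
proof -
  have BA: "B ** A = mat 1" using AB by (simp add: matrix_left_right_inverse)
  \<comment> \<open>\<open>matrix_inv\<close> is a Hilbert choice of a two-sided inverse;
    \<open>B\<close> witnesses that one exists, and uniqueness of inverses then identifies the
    choice with \<open>B\<close>.\<close>
  have "A ** matrix_inv A = mat 1 \<and> matrix_inv A ** A = mat 1"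
    unfolding matrix_inv_def by (rule someI[of _ B]) (simp add: AB BA)
  then show ?thesis
    by (metis AB matrix_mul_assoc matrix_mul_lid matrix_mul_rid)
qed

lemma matrix_inv_pos_diagonal:
  fixes S :: "real^'n^'n"
  assumes "pos_diagonal S"
  shows "matrix_inv S = (\<chi> i j. if i = j then 1 / S $ i $ i else 0)"
proof (rule matrix_inv_eqI)
  have off: "i \<noteq> j \<Longrightarrow> S $ i $ j = 0" and pos: "S $ i $ i \<noteq> 0" for i j
    using assms by (auto simp: pos_diagonal_def less_imp_neq[symmetric])
  have "(\<Sum>k\<in>UNIV. S $ i $ k * (if k = j then 1 / S $ k $ k else 0)) = (if i = j then 1 else 0)" for i j
    using off[of i j] pos[of j] by (simp add: if_distrib[of "\<lambda>t. _ * t"] cong: if_cong)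
  then show "S ** (\<chi> i j. if i = j then 1 / S $ i $ i else 0) = mat 1"
    by (simp add: matrix_matrix_mult_def mat_def vec_eq_iff)
qed

lemma matrix_inv_pos_diagonal_vec:
  fixes S :: "real^'n^'n"
  assumes "pos_diagonal S"
  shows "(matrix_inv S *v v) $ i = v $ i / S $ i $ i"
proof -
  have "matrix_inv S $ i $ j * v $ j = (if j = i then v $ i / S $ i $ i else 0)" for j
    using assms by (simp add: matrix_inv_pos_diagonal)
  then show ?thesis by (simp add: matrix_vector_mult_def)
qed

lemma pos_diagonal_vec:
  fixes S :: "real^'n^'n"
  assumes "pos_diagonal S"
  shows "(S *v v) $ i = S $ i $ i * v $ i"
proof -
  have "S $ i $ j * v $ j = (if j = i then S $ i $ i * v $ i else 0)" for j
    using assms by (auto simp: pos_diagonal_def)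
  then have "(\<Sum>j\<in>UNIV. S $ i $ j * v $ j) = (\<Sum>j\<in>UNIV. if j = i then S $ i $ i * v $ i else 0)"
    by (intro sum.cong refl)
  then show ?thesis by (simp add: matrix_vector_mult_def)
qed

lemma sqrt_prod: "sqrt (\<Prod>i\<in>A. f i) = (\<Prod>i\<in>A. sqrt (f i))"
  by (induction A rule: infinite_finite_induct) (simp_all add: real_sqrt_mult)

text \<open>The determinant is the product of the diagonal entries and the quadratic form is a sum
  over coordinates, so normalization and exponential both factor. The square root appears because
  \<open>normal_density\<close> takes a standard deviation.\<close>

lemma mvn_density_pos_diagonal:
  fixes S :: "real^'n^'n"
  assumes S: "pos_diagonal S"
  shows "mvn_density m S x = (\<Prod>i\<in>UNIV. normal_density (m $ i) (sqrt (S $ i $ i)) (x $ i))"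
proof -
  have pos: "0 < S $ i $ i" for i using S by (simp add: pos_diagonal_def)
  have "det S = (\<Prod>i\<in>UNIV. S $ i $ i)"
    using S by (intro det_diagonal) (auto simp: pos_diagonal_def)
  then have "(2 * pi) ^ CARD('n) * det S = (\<Prod>i\<in>UNIV. 2 * pi * S $ i $ i)"
    by (simp add: prod.distrib)
  then have den: "sqrt ((2 * pi) ^ CARD('n) * det S) = (\<Prod>i\<in>UNIV. sqrt (2 * pi * S $ i $ i))"
    by (simp only: sqrt_prod)
  have "- ((x - m) \<bullet> (matrix_inv S *v (x - m))) / 2 = (\<Sum>i\<in>UNIV. - (x $ i - m $ i)\<^sup>2 / (2 * S $ i $ i))"
    by (simp add: inner_vec_def matrix_inv_pos_diagonal_vec[OF S] sum_divide_distrib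
        power2_eq_square mult.commute flip: sum_negf)
  then have num: "exp (- ((x - m) \<bullet> (matrix_inv S *v (x - m))) / 2)
      = (\<Prod>i\<in>UNIV. exp (- (x $ i - m $ i)\<^sup>2 / (2 * S $ i $ i)))"
    by (simp only: exp_sum[OF finite])
  show ?thesis
    unfolding mvn_density_def num den prod_dividef[symmetric]
    by (intro prod.cong refl) (use pos in \<open>simp add: normal_density_def less_imp_le\<close>)
qed

lemma
  fixes S :: "real^'n^'n"
  assumes S: "pos_diagonal S"
  shows integrable_mvn_moment:
      "integrable lborel (\<lambda>x. mvn_density m S x * (\<Prod>i\<in>UNIV. (x $ i - m $ i) ^ k i))"
    and integral_mvn_moment:
      "(\<integral>x. mvn_density m S x * (\<Prod>i\<in>UNIV. (x $ i - m $ i) ^ k i) \<partial>lborel)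
        = (\<Prod>i\<in>UNIV. \<integral>t. normal_density (m $ i) (sqrt (S $ i $ i)) t * (t - m $ i) ^ k i \<partial>lborel)"
proof -
  have pos: "0 < sqrt (S $ i $ i)" for i using S by (simp add: pos_diagonal_def)
  show "integrable lborel (\<lambda>x. mvn_density m S x * (\<Prod>i\<in>UNIV. (x $ i - m $ i) ^ k i))"
    unfolding mvn_density_pos_diagonal[OF S] prod.distrib[symmetric]
    by (rule integrable_lborel_prod_vec[where f="\<lambda>i t. normal_density (m $ i) (sqrt (S $ i $ i)) t * (t - m $ i) ^ k i"])
      (rule integrable_normal_moment[OF pos])
  show "(\<integral>x. mvn_density m S x * (\<Prod>i\<in>UNIV. (x $ i - m $ i) ^ k i) \<partial>lborel)
        = (\<Prod>i\<in>UNIV. \<integral>t. normal_density (m $ i) (sqrt (S $ i $ i)) t * (t - m $ i) ^ k i \<partial>lborel)"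
    unfolding mvn_density_pos_diagonal[OF S] prod.distrib[symmetric]
    by (rule integral_lborel_prod_vec[where f="\<lambda>i t. normal_density (m $ i) (sqrt (S $ i $ i)) t * (t - m $ i) ^ k i"])
      (rule integrable_normal_moment[OF pos])
qed

lemma prod_if_power:
  fixes y :: "'n::finite \<Rightarrow> real"
  shows "(\<Prod>l\<in>UNIV. y l ^ (if l = i then p else 0)) = y i ^ p"
proof -
  have "y l ^ (if l = i then p else 0) = (if l = i then y i ^ p else 1)" for l by simp
  then show ?thesis by simp
qed

text \<open>Puts a monomial in two coordinates into the form of a product over all coordinates, as
  the moment formulas demand. Adding the two exponents covers \<open>i = j\<close> without a case
  distinction.\<close>

lemma prod_two_coords:
  fixes y :: "'n::finite \<Rightarrow> real"
  shows "(\<Prod>l\<in>UNIV. y l ^ ((if l = i then p else 0) + (if l = j then q else 0))) = y i ^ p * y j ^ q"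
  by (simp only: power_add prod.distrib prod_if_power)

lemma
  fixes S :: "real^'n^'n"
  assumes S: "pos_diagonal S"
  shows integrable_mvn_two_coords:
      "integrable lborel (\<lambda>x. mvn_density m S x * ((x $ i - m $ i) ^ p * (x $ j - m $ j) ^ q))"
    and integral_mvn_coord: "(\<integral>x. mvn_density m S x * (x $ i - m $ i) \<partial>lborel) = 0"
    and integral_mvn_two_coords:
      "(\<integral>x. mvn_density m S x * ((x $ i - m $ i) * (x $ j - m $ j)) \<partial>lborel) = (if i = j then S $ i $ i else 0)"
proof -
  have pos: "0 < sqrt (S $ i $ i)" "0 \<le> S $ i $ i" for i
    using S by (auto simp: pos_diagonal_def less_imp_le)
  define N where "N l k = (\<integral>t. normal_density (m $ l) (sqrt (S $ l $ l)) t * (t - m $ l) ^ k \<partial>lborel)" for l k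
  have N: "N l 0 = 1" "N l (Suc 0) = 0" "N l (Suc (Suc 0)) = S $ l $ l" for l
    using integral_normal_moment_even[OF pos(1), of "m $ l" l 0] integral_normal_moment_even[OF pos(1), of "m $ l" l 1]
      integral_normal_moment_odd[OF pos(1), of "m $ l" l 0] pos[of l]
    by (simp_all add: N_def eval_nat_numeral)
  show "integrable lborel (\<lambda>x. mvn_density m S x * ((x $ i - m $ i) ^ p * (x $ j - m $ j) ^ q))"
    using integrable_mvn_moment[OF S, of m "\<lambda>l. (if l = i then p else 0) + (if l = j then q else 0)"]
    unfolding prod_two_coords .
  have "(\<integral>x. mvn_density m S x * ((x $ i - m $ i) ^ 1 * (x $ j - m $ j) ^ q) \<partial>lborel)
     = (\<Prod>l\<in>UNIV. N l ((if l = i then 1 else 0) + (if l = j then q else 0)))" for q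
    using integral_mvn_moment[OF S, of m "\<lambda>l. (if l = i then 1 else 0) + (if l = j then q else 0)"]
    unfolding prod_two_coords N_def .
  note eq = this
  \<comment> \<open>The first moment is the two-coordinate case with \<open>q = 0\<close>. The
    factor at \<open>l = i\<close> is a first central moment, hence zero.\<close>
  have "(\<Prod>l\<in>UNIV. N l ((if l = i then 1 else 0) + (if l = i then 0 else 0))) = 0"
    by (rule prod_zero) (auto intro!: bexI[of _ i] simp: N)
  then show "(\<integral>x. mvn_density m S x * (x $ i - m $ i) \<partial>lborel) = 0"
    using integral_mvn_moment[OF S, of m "\<lambda>l. (if l = i then 1 else 0) + (if l = i then 0 else 0)"]
    unfolding prod_two_coords N_def by simp
  have "(\<Prod>l\<in>UNIV. N l ((if l = i then 1 else 0) + (if l = j then 1 else 0))) = (if i = j then S $ i $ i else 0)"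
  proof (cases "i = j")
    case True
    then have "N l ((if l = i then 1 else 0) + (if l = j then 1 else 0)) = (if l = i then S $ i $ i else 1)" for l
      by (simp add: N)
    then show ?thesis using True by simp
  next
    case False
    then show ?thesis by (intro trans[OF prod_zero]) (auto intro!: bexI[of _ i] simp: N)
  qed
  then show "(\<integral>x. mvn_density m S x * ((x $ i - m $ i) * (x $ j - m $ j)) \<partial>lborel) = (if i = j then S $ i $ i else 0)"
    using eq[of 1] by simp
qed

section \<open>The score of the Gaussian target, and null sets of continuous laws\<close>

lemma pos_definite_invertible:
  fixes A :: "real^'n^'n"
  assumes "pos_definite A"
  shows "invertible A"
proof -
  have "A *v x = 0 \<Longrightarrow> x = 0" for x
    using assms by (metis pos_definite_def inner_zero_right less_irrefl)
  then show ?thesis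
    by (simp add: invertible_left_inverse matrix_left_invertible_ker)
qed

text \<open>Up to an additive constant the log density is minus half the quadratic form of \<Lambda>
  at \<open>x - \<nu>\<close>, because inverting the covariance gives back \<Lambda>.\<close>

lemma score_mvn_density:
  fixes \<Lambda> :: "real^'n^'n"
  assumes \<Lambda>: "pos_definite \<Lambda>"
  shows "score (mvn_density \<nu> (matrix_inv \<Lambda>)) x = - (\<Lambda> *v (x - \<nu>))"
proof -
  have inv: "\<Lambda> ** matrix_inv \<Lambda> = mat 1" "matrix_inv \<Lambda> ** \<Lambda> = mat 1"
    using someI_ex[OF pos_definite_invertible[OF \<Lambda>, unfolded invertible_def]]
    by (auto simp: matrix_inv_def)
  have invinv: "matrix_inv (matrix_inv \<Lambda>) = \<Lambda>"
    by (rule matrix_inv_eqI) (rule inv)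
  have "invertible (matrix_inv \<Lambda>)" using inv by (auto simp: invertible_def)
  then have "det (matrix_inv \<Lambda>) \<noteq> 0" by (simp add: invertible_det_nz)
  \<comment> \<open>A nonzero determinant suffices, since \<^term>\<open>ln\<close> satisfies \<open>ln (- x) = ln x\<close> on the reals.\<close>
  then obtain C where C: "ln (mvn_density \<nu> (matrix_inv \<Lambda>) t) = - ((t - \<nu>) \<bullet> (\<Lambda> *v (t - \<nu>))) / 2 - C" for t
    unfolding mvn_density_def invinv by (simp add: ln_div)
  \<comment> \<open>Symmetry merges the two terms of the product rule below, which cancels the
    factor one half.\<close>
  have sym: "u \<bullet> (\<Lambda> *v v) = v \<bullet> (\<Lambda> *v u)" for u v
    using \<Lambda> by (metis pos_definite_def dot_lmul_matrix inner_commute transpose_matrix_vector)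
  have lin: "((*v) \<Lambda> has_derivative (*v) \<Lambda>) F" for F
    by (rule bounded_linear_imp_has_derivative) (simp add: linear_linear)
  have der: "((\<lambda>t. \<Lambda> *v (t - \<nu>)) has_derivative (\<lambda>h. \<Lambda> *v h)) (at x)"
    by (rule has_derivative_compose[OF _ lin, of "\<lambda>t. t - \<nu>" "\<lambda>h. h" x UNIV])
      (auto intro!: derivative_eq_intros)
  have D: "GDERIV (\<lambda>t. ln (mvn_density \<nu> (matrix_inv \<Lambda>) t)) x :> - (\<Lambda> *v (x - \<nu>))"
  proof -
    have "((\<lambda>t. t - \<nu>) has_derivative (\<lambda>h. h)) (at x)"
      by (auto intro!: derivative_eq_intros)
    from has_derivative_mult_right[OF has_derivative_inner[OF this der], of "- 1 / 2"]
    have quad: "((\<lambda>t. - ((t - \<nu>) \<bullet> (\<Lambda> *v (t - \<nu>))) / 2) has_derivative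
        (\<lambda>h. - ((x - \<nu>) \<bullet> (\<Lambda> *v h) + h \<bullet> (\<Lambda> *v (x - \<nu>))) / 2)) (at x)"
      by (simp only: divide_minus_left mult_minus_left times_divide_eq_left mult_1_left)
    have "((\<lambda>t. - ((t - \<nu>) \<bullet> (\<Lambda> *v (t - \<nu>))) / 2 - C) has_derivative
        (\<lambda>h. - ((x - \<nu>) \<bullet> (\<Lambda> *v h) + h \<bullet> (\<Lambda> *v (x - \<nu>))) / 2 - 0)) (at x)"
      by (intro has_derivative_diff quad has_derivative_const)
    also have "(\<lambda>h. - ((x - \<nu>) \<bullet> (\<Lambda> *v h) + h \<bullet> (\<Lambda> *v (x - \<nu>))) / 2 - 0)
        = (\<lambda>h. h \<bullet> - (\<Lambda> *v (x - \<nu>)))"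
    proof (rule ext)
      fix h
      show "- ((x - \<nu>) \<bullet> (\<Lambda> *v h) + h \<bullet> (\<Lambda> *v (x - \<nu>))) / 2 - 0 = h \<bullet> - (\<Lambda> *v (x - \<nu>))"
        unfolding sym[of "x - \<nu>" h] by simp
    qed
    finally show ?thesis
      unfolding C gderiv_def .
  qed
  show ?thesis
    unfolding score_def
  \<comment> \<open>\<open>score\<close> is a definite description, so uniqueness of the gradient is
    needed besides its existence.\<close>
  proof (rule the_equality)
    show "GDERIV (\<lambda>t. ln (mvn_density \<nu> (matrix_inv \<Lambda>) t)) x :> - (\<Lambda> *v (x - \<nu>))" by (rule D)
    fix D' assume "GDERIV (\<lambda>t. ln (mvn_density \<nu> (matrix_inv \<Lambda>) t)) x :> D'"
    then have "(\<lambda>h. h \<bullet> D') = (\<lambda>h. h \<bullet> - (\<Lambda> *v (x - \<nu>)))"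
      using D unfolding gderiv_def by (rule has_derivative_unique)
    then show "D' = - (\<Lambda> *v (x - \<nu>))"
      by (metis vector_eq_rdot inner_commute)
  qed
qed

text \<open>Hyperplanes are Lebesgue null sets, and a law with a density inherits null sets from
  Lebesgue measure.\<close>

lemma AE_distributed_not_in_hyperplane:
  fixes X :: "'a \<Rightarrow> 'b::euclidean_space"
  assumes X: "distributed M lborel X f" and "c \<noteq> 0"
  shows "AE x in M. c \<bullet> X x \<noteq> t"
proof -
  have "negligible {x. c \<bullet> x = t}" using assms by (simp add: negligible_hyperplane)
  \<comment> \<open>Negligibility refers to the completed measure; since the hyperplane is a Borel
    set, it passes to \<open>lborel\<close>.\<close>
  then have "{x. c \<bullet> x = t} \<in> null_sets lborel"
    by (subst null_sets_completion_iff[symmetric]) (auto simp: negligible_iff_null_sets)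
  then have "AE x in lborel. x \<notin> {x. c \<bullet> x = t}" by (rule AE_not_in)
  then have "AE x in density lborel f. c \<bullet> x \<noteq> t"
    using X by (subst AE_density) (auto simp: distributed_def)
  then have "AE x in distr M lborel X. c \<bullet> x \<noteq> t"
    unfolding distributed_distr_eq_density[OF X] .
  then show ?thesis
    using X by (subst (asm) AE_distr_iff) (auto simp: distributed_def)
qed

section \<open>Minimizers of the batch divergences\<close>

definition smean :: "nat \<Rightarrow> (nat \<Rightarrow> real) \<Rightarrow> real" where
  "smean B x = (1 / real B) * (\<Sum>k<B. x k)"

text \<open>The empirical covariance with divisor \<open>B\<close> rather than \<open>B - 1\<close>.
  The uncentred form makes bilinearity and the passage to limits direct.\<close>

definition scov :: "nat \<Rightarrow> (nat \<Rightarrow> real) \<Rightarrow> (nat \<Rightarrow> real) \<Rightarrow> real" where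
  "scov B x y = smean B (\<lambda>k. x k * y k) - smean B x * smean B y"

lemma smean_add: "smean B (\<lambda>k. x k + y k) = smean B x + smean B y"
  by (simp add: smean_def sum.distrib ring_distribs)

lemma smean_cmult: "smean B (\<lambda>k. c * x k) = c * smean B x"
  by (simp add: smean_def sum_distrib_left)

lemma smean_const: "0 < B \<Longrightarrow> smean B (\<lambda>k. c) = c"
  by (simp add: smean_def)

lemma smean_sum: "smean B (\<lambda>k. \<Sum>j\<in>A. x j k) = (\<Sum>j\<in>A. smean B (x j))"
  by (simp add: smean_def sum_distrib_left sum.swap[of _ A])

lemma scov_commute: "scov B x y = scov B y x"
  by (simp add: scov_def mult.commute)

text \<open>Made for the scores: each of their coordinates is an affine combination of the sample
  coordinates, and the additive constant drops out of a covariance.\<close>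

lemma scov_sum_left:
  assumes "0 < B"
  shows "scov B (\<lambda>k. (\<Sum>j\<in>A. a j * x j k) + c) y = (\<Sum>j\<in>A. a j * scov B (x j) y)"
proof -
  have "((\<Sum>j\<in>A. a j * x j k) + c) * y k = (\<Sum>j\<in>A. a j * (x j k * y k)) + c * y k" for k
    by (simp add: ring_distribs sum_distrib_right mult.assoc)
  then show ?thesis
    by (simp add: scov_def smean_add smean_sum smean_cmult smean_const assms ring_distribs
        sum_distrib_left sum_distrib_right sum_subtractf mult.assoc)
qed

lemma scov_shift:
  assumes "0 < B"
  shows "scov B (\<lambda>k. x k - a) (\<lambda>k. y k - b) = scov B x y"
proof -
  have left: "scov B (\<lambda>k. x k - a) y = scov B x y" for x y a
    using scov_sum_left[OF assms, of "\<lambda>_. 1" "\<lambda>_. x" "{()}" "- a" y] by simp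
  show ?thesis
    using left[of x a "\<lambda>k. y k - b"] left[of y b x] by (simp add: scov_commute[of B x])
qed

lemma scov_self: "0 < B \<Longrightarrow> scov B x x = smean B (\<lambda>k. (x k - smean B x)\<^sup>2)"
proof -
  assume B: "0 < B"
  have "(x k - smean B x)\<^sup>2 = x k * x k + (- (2 * smean B x)) * x k + (smean B x)\<^sup>2" for k
    by (simp add: power2_eq_square algebra_simps)
  then have "smean B (\<lambda>k. (x k - smean B x)\<^sup>2)
      = smean B (\<lambda>k. x k * x k + (- (2 * smean B x)) * x k + (smean B x)\<^sup>2)"
    by (simp only:)
  also have "\<dots> = scov B x x"
    unfolding smean_add smean_cmult smean_const[OF B] by (simp add: scov_def power2_eq_square)
  finally show ?thesis by simp
qed

lemma scov_self_pos:
  assumes "1 < B" and "x 0 \<noteq> x 1"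
  shows "0 < scov B x x"
proof -
  \<comment> \<open>Since \<open>x 0\<close> and \<open>x 1\<close> differ and both indices are
    below \<open>B\<close>, at least one of the two values differs from the mean.\<close>
  obtain k where k: "k < B" "x k \<noteq> smean B x"
    using assms by (metis One_nat_def less_trans zero_less_one)
  then have "0 < (\<Sum>k<B. (x k - smean B x)\<^sup>2)"
    by (intro sum_pos2[of _ k]) auto
  then show ?thesis using assms by (simp add: scov_self) (simp add: smean_def)
qed

text \<open>A mean square is a variance plus a squared mean, here for
  \<open>y + (x - m) / s\<close>. Only the squared mean involves \<open>m\<close>.\<close>

lemma smean_residual_square:
  assumes "0 < B"
  shows "smean B (\<lambda>k. (y k + (x k - m) / s)\<^sup>2)
    = scov B y y + 2 * scov B x y / s + scov B x x / s\<^sup>2 + (smean B y + (smean B x - m) / s)\<^sup>2"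
proof -
  have "(y k + (x k - m) / s)\<^sup>2 = y k * y k + (2 / s) * (x k * y k) + (1 / s\<^sup>2) * (x k * x k)
      + (- (2 * m / s)) * y k + (- (2 * m / s\<^sup>2)) * x k + m\<^sup>2 / s\<^sup>2" for k
    by (cases "s = 0") (simp_all add: power2_eq_square field_simps)
  then have "smean B (\<lambda>k. (y k + (x k - m) / s)\<^sup>2)
      = smean B (\<lambda>k. y k * y k + (2 / s) * (x k * y k) + (1 / s\<^sup>2) * (x k * x k)
      + (- (2 * m / s)) * y k + (- (2 * m / s\<^sup>2)) * x k + m\<^sup>2 / s\<^sup>2)"
    by (simp only:)
  also have "\<dots> = scov B y y + 2 * scov B x y / s + scov B x x / s\<^sup>2 + (smean B y + (smean B x - m) / s)\<^sup>2"
    unfolding smean_add smean_cmult smean_const[OF assms] scov_def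
    by (cases "s = 0") (simp_all add: power2_eq_square field_simps)
  finally show ?thesis .
qed

section \<open>Splitting the divergences into coordinates and minimizing each one\<close>

lemma batch_fisher_div_coords:
  fixes S :: "real^'n^'n"
  assumes S: "pos_diagonal S"
  shows "batch_fisher_div g B t (m, S) =
    (\<Sum>i\<in>UNIV. smean B (\<lambda>k. (g (t k) $ i + (t k $ i - m $ i) / S $ i $ i)\<^sup>2))"
  unfolding batch_fisher_div_def smean_sum[symmetric]
  unfolding power2_norm_eq_inner inner_vec_def
  by (simp add: smean_def matrix_inv_pos_diagonal_vec[OF S] power2_eq_square)

lemma batch_score_div_coords:
  fixes S :: "real^'n^'n"
  assumes S: "pos_diagonal S"
  shows "batch_score_div g B t (m, S) =
    (\<Sum>i\<in>UNIV. S $ i $ i * smean B (\<lambda>k. (g (t k) $ i + (t k $ i - m $ i) / S $ i $ i)\<^sup>2))"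
  unfolding batch_score_div_def smean_cmult[symmetric] smean_sum[symmetric]
  by (simp add: smean_def Let_def inner_vec_def matrix_inv_pos_diagonal_vec[OF S] pos_diagonal_vec[OF S]
      power2_eq_square mult.left_commute)

text \<open>The coordinates can be varied independently, so strict minimizers of the summands
  combine to the unique minimizer of the sum. A feasible matrix is determined by its diagonal, so a
  competitor must differ in some pair \<open>(m $ i, S $ i $ i)\<close>.\<close>

lemma is_minimizer_coords_iff:
  fixes m0 :: "'n::finite \<Rightarrow> real"
  assumes D: "\<And>m S. pos_diagonal S \<Longrightarrow> D (m, S) = (\<Sum>i\<in>UNIV. \<phi> i (m $ i) (S $ i $ i))"
    and s0: "\<And>i. 0 < s0 i"
    and less: "\<And>i m s. 0 < s \<Longrightarrow> (m, s) \<noteq> (m0 i, s0 i) \<Longrightarrow> \<phi> i (m0 i) (s0 i) < \<phi> i m s"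
  shows "is_minimizer D l \<longleftrightarrow> l = (\<chi> i. m0 i, \<chi> i j. if i = j then s0 i else 0)"
proof -
  define l0 :: "(real^'n) \<times> (real^'n^'n)" where "l0 = (\<chi> i. m0 i, \<chi> i j. if i = j then s0 i else 0)"
  have feas: "pos_diagonal (snd l0)" using s0 by (simp add: l0_def pos_diagonal_def)
  have strict: "D l0 < D (m, S)" if S: "pos_diagonal S" and ne: "(m, S) \<noteq> l0" for m S
  proof -
    have pos: "0 < S $ i $ i" for i using S by (simp add: pos_diagonal_def)
    have off: "i \<noteq> j \<Longrightarrow> S $ i $ j = 0" for i j using S by (simp add: pos_diagonal_def)
    have le: "\<phi> i (m0 i) (s0 i) \<le> \<phi> i (m $ i) (S $ i $ i)" for i
      using less[OF pos[of i], of "m $ i" i] by (cases "(m $ i, S $ i $ i) = (m0 i, s0 i)") auto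
    have "\<exists>i. (m $ i, S $ i $ i) \<noteq> (m0 i, s0 i)"
    proof (rule ccontr)
      assume "\<not> ?thesis"
      then have "m = (\<chi> i. m0 i)" "S = (\<chi> i j. if i = j then s0 i else 0)"
        using off by (auto simp: vec_eq_iff)
      with ne show False by (simp add: l0_def)
    qed
    then obtain i where "(m $ i, S $ i $ i) \<noteq> (m0 i, s0 i)" ..
    from less[OF pos this] le
    have "(\<Sum>i\<in>UNIV. \<phi> i (m0 i) (s0 i)) < (\<Sum>i\<in>UNIV. \<phi> i (m $ i) (S $ i $ i))"
      by (intro sum_strict_mono_ex1) auto
    then show ?thesis using D[OF S] D[OF feas, of "fst l0"] by (simp add: l0_def)
  qed
  have "is_minimizer D l \<longleftrightarrow> l = l0"
    unfolding is_minimizer_def is_arg_min_def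
  proof
    assume l: "(case l of (m, S) \<Rightarrow> pos_diagonal S) \<and> \<not> (\<exists>y. (case y of (m, S) \<Rightarrow> pos_diagonal S) \<and> D y < D l)"
    show "l = l0"
    proof (rule ccontr)
      assume "l \<noteq> l0"
      then have "D l0 < D l" using l strict[of "snd l" "fst l"] by (simp add: case_prod_unfold)
      with l feas show False by (metis case_prod_unfold)
    qed
  next
    assume "l = l0"
    then show "(case l of (m, S) \<Rightarrow> pos_diagonal S) \<and> \<not> (\<exists>y. (case y of (m, S) \<Rightarrow> pos_diagonal S) \<and> D y < D l)"
      using feas strict by (fastforce simp: case_prod_unfold)
  qed
  then show ?thesis unfolding l0_def .
qed

text \<open>Multiplying by \<open>s\<close> turns the \<open>c\<close> term into the constant
  \<open>2 * c\<close>, so the sign of \<open>c\<close> does not matter. With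
  \<open>b = a * s0^2\<close> the excess over the minimum is
  \<open>a * (s - s0)^2 / s + (u + s * v - m)^2 / s\<close>.\<close>

lemma score_coord_minimum:
  fixes a b c s s0 u v m :: real
  assumes "0 < a" "0 < b" "0 < s" and s0: "s0 = sqrt (b / a)" and ne: "(m, s) \<noteq> (u + s0 * v, s0)"
  shows "s0 * (a + 2 * c / s0 + b / s0\<^sup>2 + (v + (u - (u + s0 * v)) / s0)\<^sup>2)
    < s * (a + 2 * c / s + b / s\<^sup>2 + (v + (u - m) / s)\<^sup>2)"
proof -
  have s0pos: "0 < s0" and b: "b = a * s0\<^sup>2" using assms by (auto simp: field_simps)
  have "s * (a + 2 * c / s + b / s\<^sup>2 + (v + (u - m) / s)\<^sup>2)
      - s0 * (a + 2 * c / s0 + b / s0\<^sup>2 + (v + (u - (u + s0 * v)) / s0)\<^sup>2)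
      = a * (s - s0)\<^sup>2 / s + (u + s * v - m)\<^sup>2 / s"
    unfolding b using s0pos \<open>0 < s\<close> by (simp add: power2_eq_square field_simps)
  moreover have "0 < a * (s - s0)\<^sup>2 / s + (u + s * v - m)\<^sup>2 / s"
  proof (cases "s = s0")
    case True
    then show ?thesis using ne assms by simp
  next
    case False
    then have "0 < a * (s - s0)\<^sup>2 / s" using assms(1,3) by simp
    then show ?thesis using \<open>0 < s\<close> by (intro add_pos_nonneg) auto
  qed
  ultimately show ?thesis by simp
qed

text \<open>Apart from the square containing \<open>m\<close>, the expression is a quadratic in
  \<open>1 / s\<close> with leading coefficient \<open>b\<close> and vertex \<open>- c / b\<close>.
  The condition \<open>c < 0\<close> makes this vertex positive, so it is attained at an admissible
  \<open>s0\<close>.\<close>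

lemma fisher_coord_minimum:
  fixes a b c s s0 u v m :: real
  assumes "c < 0" "0 < b" "0 < s" and s0: "s0 = b / (- c)" and ne: "(m, s) \<noteq> (u + s0 * v, s0)"
  shows "a + 2 * c / s0 + b / s0\<^sup>2 + (v + (u - (u + s0 * v)) / s0)\<^sup>2
    < a + 2 * c / s + b / s\<^sup>2 + (v + (u - m) / s)\<^sup>2"
proof -
  have s0pos: "0 < s0" unfolding s0 using assms(1,2) by (intro divide_pos_pos) auto
  have c: "c = - b / s0" unfolding s0 using assms(1,2) by simp
  have "(a + 2 * c / s + b / s\<^sup>2 + (v + (u - m) / s)\<^sup>2)
      - (a + 2 * c / s0 + b / s0\<^sup>2 + (v + (u - (u + s0 * v)) / s0)\<^sup>2)
      = b * (1 / s - 1 / s0)\<^sup>2 + (u + s * v - m)\<^sup>2 / s\<^sup>2"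
    unfolding c using s0pos \<open>0 < s\<close> by (simp add: power2_eq_square field_simps)
  moreover have "0 < b * (1 / s - 1 / s0)\<^sup>2 + (u + s * v - m)\<^sup>2 / s\<^sup>2"
  proof (cases "s = s0")
    case True
    then show ?thesis using ne assms by simp
  next
    case False
    then have "0 < b * (1 / s - 1 / s0)\<^sup>2" using assms(2,3) s0pos by (simp add: field_simps)
    then show ?thesis by (intro add_pos_nonneg) auto
  qed
  ultimately show ?thesis by simp
qed

lemma is_minimizer_batch_score_div_iff:
  fixes g :: "real^'n \<Rightarrow> real^'n"
  defines "x \<equiv> \<lambda>t i k. t k $ i" and "y \<equiv> \<lambda>t i k. g (t k) $ i"
  defines "s \<equiv> \<lambda>B t i. sqrt (scov B (x t i) (x t i) / scov B (y t i) (y t i))"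
  assumes "0 < B" and "\<And>i. 0 < scov B (x t i) (x t i)" and "\<And>i. 0 < scov B (y t i) (y t i)"
  shows "is_minimizer (batch_score_div g B t) l \<longleftrightarrow>
    l = (\<chi> i. smean B (x t i) + s B t i * smean B (y t i), \<chi> i j. if i = j then s B t i else 0)"
proof (rule is_minimizer_coords_iff)
  show "batch_score_div g B t (m, S) = (\<Sum>i\<in>UNIV. S $ i $ i * smean B (\<lambda>k. (y t i k + (x t i k - m $ i) / S $ i $ i)\<^sup>2))"
    if "pos_diagonal S" for m S
    using that by (simp add: batch_score_div_coords x_def y_def)
  show "0 < s B t i" for i using assms by (simp add: s_def)
  fix i m r assume "0 < r" "(m, r) \<noteq> (smean B (x t i) + s B t i * smean B (y t i), s B t i)"
  then show "s B t i * smean B (\<lambda>k. (y t i k + (x t i k - (smean B (x t i) + s B t i * smean B (y t i))) / s B t i)\<^sup>2)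
      < r * smean B (\<lambda>k. (y t i k + (x t i k - m) / r)\<^sup>2)"
    unfolding smean_residual_square[OF \<open>0 < B\<close>]
    by (intro score_coord_minimum assms(5,6)) (auto simp: s_def)
qed

lemma is_minimizer_batch_fisher_div_iff:
  fixes g :: "real^'n \<Rightarrow> real^'n"
  defines "x \<equiv> \<lambda>t i k. t k $ i" and "y \<equiv> \<lambda>t i k. g (t k) $ i"
  defines "s \<equiv> \<lambda>B t i. scov B (x t i) (x t i) / (- scov B (x t i) (y t i))"
  assumes "0 < B" and "\<And>i. 0 < scov B (x t i) (x t i)" and "\<And>i. scov B (x t i) (y t i) < 0"
  shows "is_minimizer (batch_fisher_div g B t) l \<longleftrightarrow>
    l = (\<chi> i. smean B (x t i) + s B t i * smean B (y t i), \<chi> i j. if i = j then s B t i else 0)"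
proof (rule is_minimizer_coords_iff)
  show "batch_fisher_div g B t (m, S) = (\<Sum>i\<in>UNIV. smean B (\<lambda>k. (y t i k + (x t i k - m $ i) / S $ i $ i)\<^sup>2))"
    if "pos_diagonal S" for m S
    using that by (simp add: batch_fisher_div_coords x_def y_def)
  show "0 < s B t i" for i
    unfolding s_def using assms(5,6)[of i] by (intro divide_pos_pos) auto
  fix i m r assume "0 < r" "(m, r) \<noteq> (smean B (x t i) + s B t i * smean B (y t i), s B t i)"
  then show "smean B (\<lambda>k. (y t i k + (x t i k - (smean B (x t i) + s B t i * smean B (y t i))) / s B t i)\<^sup>2)
      < smean B (\<lambda>k. (y t i k + (x t i k - m) / r)\<^sup>2)"
    unfolding smean_residual_square[OF \<open>0 < B\<close>]
    by (intro fisher_coord_minimum assms(5,6)) (auto simp: s_def)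
qed

section \<open>Almost sure limits of sample moments\<close>

context prob_space
begin

lemma strong_law_distributed:
  fixes \<theta> :: "nat \<Rightarrow> 'a \<Rightarrow> 'b::euclidean_space" and h :: "'b \<Rightarrow> real"
  assumes indep: "indep_vars (\<lambda>_. borel) \<theta> UNIV"
    and dist: "\<And>k. distributed M lborel (\<theta> k) (\<lambda>x. ennreal (f x))"
    and nn: "\<And>x. 0 \<le> f x"
    and [measurable]: "h \<in> borel_measurable borel"
    and int: "integrable lborel (\<lambda>x. f x * h x ^ 4)"
  shows "AE \<omega> in M. (\<lambda>n. smean n (\<lambda>k. h (\<theta> k \<omega>))) \<longlonglongrightarrow> (\<integral>x. f x * h x \<partial>lborel)"
  unfolding smean_def
proof (rule strong_law_power4)
  let ?c = "\<integral>x. f x * h x \<partial>lborel"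
  show "indep_vars (\<lambda>_. borel) (\<lambda>k \<omega>. h (\<theta> k \<omega>)) UNIV"
    by (rule indep_vars_compose2[OF indep]) simp
  show "integrable M (\<lambda>\<omega>. h (\<theta> k \<omega>) ^ 4)" for k
    using distributed_integrable[OF dist, of "\<lambda>x. h x ^ 4" k] int nn by simp
  show "expectation (\<lambda>\<omega>. h (\<theta> k \<omega>)) = ?c" for k
    using distributed_integral[OF dist, of h k] nn by simp
  \<comment> \<open>All samples have the same law, so their common fourth central moment serves as
    the uniform bound.\<close>
  show "expectation (\<lambda>\<omega>. (h (\<theta> k \<omega>) - ?c) ^ 4) \<le> (\<integral>x. f x * (h x - ?c) ^ 4 \<partial>lborel)" for k
    using distributed_integral[OF dist, of "\<lambda>x. (h x - ?c) ^ 4" k] nn by simp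
qed

lemma
  fixes \<theta> :: "nat \<Rightarrow> 'a \<Rightarrow> real^'n"
  assumes indep: "indep_vars (\<lambda>_. borel) \<theta> UNIV"
    and dist: "\<And>k. distributed M lborel (\<theta> k) (\<lambda>x. ennreal (mvn_density m S x))"
    and S: "pos_diagonal S"
  shows AE_sample_mean: "AE \<omega> in M. \<forall>i. (\<lambda>B. smean B (\<lambda>k. \<theta> k \<omega> $ i - m $ i)) \<longlonglongrightarrow> 0"
    and AE_sample_product: "AE \<omega> in M. \<forall>i j. (\<lambda>B. smean B (\<lambda>k. (\<theta> k \<omega> $ i - m $ i) * (\<theta> k \<omega> $ j - m $ j)))
      \<longlonglongrightarrow> (if i = j then S $ i $ i else 0)"
proof -
  have nn: "0 \<le> mvn_density m S x" for x
    by (simp add: mvn_density_pos_diagonal[OF S] prod_nonneg)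
  have int1: "integrable lborel (\<lambda>x. mvn_density m S x * (x $ i - m $ i) ^ 4)" for i
    using integrable_mvn_two_coords[OF S, of m i 4 i 0] by simp
  have int2: "integrable lborel (\<lambda>x. mvn_density m S x * ((x $ i - m $ i) * (x $ j - m $ j)) ^ 4)" for i j
    using integrable_mvn_two_coords[OF S, of m i 4 j 4] by (simp only: power_mult_distrib)
  have "AE \<omega> in M. (\<lambda>B. smean B (\<lambda>k. \<theta> k \<omega> $ i - m $ i)) \<longlonglongrightarrow> 0" for i
    using strong_law_distributed[OF indep dist nn _ int1] by (simp add: integral_mvn_coord[OF S])
  then show "AE \<omega> in M. \<forall>i. (\<lambda>B. smean B (\<lambda>k. \<theta> k \<omega> $ i - m $ i)) \<longlonglongrightarrow> 0"
    by (simp add: AE_all_countable)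
  have "AE \<omega> in M. (\<lambda>B. smean B (\<lambda>k. (\<theta> k \<omega> $ i - m $ i) * (\<theta> k \<omega> $ j - m $ j)))
      \<longlonglongrightarrow> (if i = j then S $ i $ i else 0)" for i j
    using strong_law_distributed[OF indep dist nn _ int2[of i j]]
    unfolding integral_mvn_two_coords[OF S] by simp
  then show "AE \<omega> in M. \<forall>i j. (\<lambda>B. smean B (\<lambda>k. (\<theta> k \<omega> $ i - m $ i) * (\<theta> k \<omega> $ j - m $ j)))
      \<longlonglongrightarrow> (if i = j then S $ i $ i else 0)"
    by (simp only: AE_all_countable) simp
qed

lemma AE_sample_inner_neq:
  fixes \<theta> :: "nat \<Rightarrow> 'a \<Rightarrow> 'b::euclidean_space"
  assumes indep: "indep_vars (\<lambda>_. borel) \<theta> UNIV"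
    and dist: "distributed M lborel (\<theta> l) f"
    and "c \<noteq> 0" and "k \<noteq> l"
  shows "AE \<omega> in M. c \<bullet> \<theta> k \<omega> \<noteq> c \<bullet> \<theta> l \<omega>"
proof (rule AE_indep_var_neq)
  \<comment> \<open>Pairwise independence is extracted from independence of one variable and a sum
    of others, where the sum has the single index \<open>l\<close>.\<close>
  have "indep_vars (\<lambda>_. borel) (\<lambda>k \<omega>. c \<bullet> \<theta> k \<omega>) {k, l}"
    by (rule indep_vars_subset[OF indep_vars_compose2[OF indep]]) auto
  then show "indep_var borel (\<lambda>\<omega>. c \<bullet> \<theta> k \<omega>) borel (\<lambda>\<omega>. c \<bullet> \<theta> l \<omega>)"
    using indep_vars_sum[of "{l}" k "\<lambda>k \<omega>. c \<bullet> \<theta> k \<omega>"] \<open>k \<noteq> l\<close> by simp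
  show "AE \<omega> in M. c \<bullet> \<theta> l \<omega> \<noteq> t" for t
    by (rule AE_distributed_not_in_hyperplane[OF dist \<open>c \<noteq> 0\<close>])
qed

end

section \<open>Limits of sample and score moments along a fixed realization\<close>

lemma pos_definite_diag:
  fixes A :: "real^'n^'n"
  assumes "pos_definite A"
  shows "0 < A $ i $ i"
proof -
  have "axis i (1::real) \<noteq> 0" by simp
  then have "0 < axis i 1 \<bullet> (A *v axis i 1)" using assms unfolding pos_definite_def by blast
  then show ?thesis by (simp add: inner_axis' matrix_vector_mul_component inner_axis)
qed

text \<open>A deterministic statement: the scores are affine in the samples, so bilinearity
  expresses all their covariances through those of the sample coordinates, whose limits form a
  diagonal matrix. Identities valid only for positive \<open>B\<close> are used eventually.\<close>

lemma
  fixes t :: "nat \<Rightarrow> real^'n" and S \<Lambda> :: "real^'n^'n"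
  assumes mean: "\<And>i. (\<lambda>B. smean B (\<lambda>k. t k $ i - m $ i)) \<longlonglongrightarrow> 0"
    and product: "\<And>i j. (\<lambda>B. smean B (\<lambda>k. (t k $ i - m $ i) * (t k $ j - m $ j)))
      \<longlonglongrightarrow> (if i = j then S $ i $ i else 0)"
    and g: "\<And>x. g x = - (\<Lambda> *v (x - \<nu>))"
  shows tendsto_smean_sample: "(\<lambda>B. smean B (\<lambda>k. t k $ i)) \<longlonglongrightarrow> m $ i"
    and tendsto_smean_score: "(\<lambda>B. smean B (\<lambda>k. g (t k) $ i)) \<longlonglongrightarrow> (\<Sum>j\<in>UNIV. \<Lambda> $ i $ j * (\<nu> $ j - m $ j))"
    and tendsto_scov_sample: "(\<lambda>B. scov B (\<lambda>k. t k $ i) (\<lambda>k. t k $ i)) \<longlonglongrightarrow> S $ i $ i"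
    and tendsto_scov_sample_score: "(\<lambda>B. scov B (\<lambda>k. t k $ i) (\<lambda>k. g (t k) $ i)) \<longlonglongrightarrow> - (S $ i $ i * \<Lambda> $ i $ i)"
    and tendsto_scov_score: "(\<lambda>B. scov B (\<lambda>k. g (t k) $ i) (\<lambda>k. g (t k) $ i)) \<longlonglongrightarrow> (\<Sum>j\<in>UNIV. S $ j $ j * (\<Lambda> $ i $ j)\<^sup>2)"
proof -
  have B: "\<forall>\<^sub>F B in sequentially. 0 < B" by (rule eventually_gt_at_top)
  have score: "g (t k) $ i = (\<Sum>j\<in>UNIV. - \<Lambda> $ i $ j * t k $ j) + (\<Sum>j\<in>UNIV. \<Lambda> $ i $ j * \<nu> $ j)" for k i
    by (simp add: g matrix_vector_mult_def sum_negf sum_subtractf right_diff_distrib)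
  show sample: "(\<lambda>B. smean B (\<lambda>k. t k $ i)) \<longlonglongrightarrow> m $ i" for i
  proof (rule Lim_transform_eventually)
    show "(\<lambda>B. smean B (\<lambda>k. t k $ i - m $ i) + m $ i) \<longlonglongrightarrow> m $ i"
      using tendsto_add[OF mean[of i] tendsto_const[of "m $ i"]] by simp
    show "\<forall>\<^sub>F B in sequentially. smean B (\<lambda>k. t k $ i - m $ i) + m $ i = smean B (\<lambda>k. t k $ i)"
      using B
    proof eventually_elim
      case (elim B)
      then show ?case using smean_add[of B "\<lambda>k. t k $ i" "\<lambda>k. - m $ i"] by (simp add: smean_const)
    qed
  qed
  have cov: "(\<lambda>B. scov B (\<lambda>k. t k $ i) (\<lambda>k. t k $ j)) \<longlonglongrightarrow> (if i = j then S $ i $ i else 0)" for i j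
  proof (rule Lim_transform_eventually)
    show "(\<lambda>B. scov B (\<lambda>k. t k $ i - m $ i) (\<lambda>k. t k $ j - m $ j)) \<longlonglongrightarrow> (if i = j then S $ i $ i else 0)"
      unfolding scov_def using tendsto_diff[OF product[of i j] tendsto_mult[OF mean[of i] mean[of j]]] by simp
    show "\<forall>\<^sub>F B in sequentially. scov B (\<lambda>k. t k $ i - m $ i) (\<lambda>k. t k $ j - m $ j)
        = scov B (\<lambda>k. t k $ i) (\<lambda>k. t k $ j)"
      using B by eventually_elim (rule scov_shift)
  qed
  show "(\<lambda>B. scov B (\<lambda>k. t k $ i) (\<lambda>k. t k $ i)) \<longlonglongrightarrow> S $ i $ i"
    using cov[of i i] by simp
  show "(\<lambda>B. smean B (\<lambda>k. g (t k) $ i)) \<longlonglongrightarrow> (\<Sum>j\<in>UNIV. \<Lambda> $ i $ j * (\<nu> $ j - m $ j))"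
  proof (rule Lim_transform_eventually)
    have "(\<lambda>B. (\<Sum>j\<in>UNIV. - \<Lambda> $ i $ j * smean B (\<lambda>k. t k $ j)) + (\<Sum>j\<in>UNIV. \<Lambda> $ i $ j * \<nu> $ j))
        \<longlonglongrightarrow> (\<Sum>j\<in>UNIV. - \<Lambda> $ i $ j * m $ j) + (\<Sum>j\<in>UNIV. \<Lambda> $ i $ j * \<nu> $ j)"
      by (intro tendsto_intros sample)
    then show "(\<lambda>B. (\<Sum>j\<in>UNIV. - \<Lambda> $ i $ j * smean B (\<lambda>k. t k $ j)) + (\<Sum>j\<in>UNIV. \<Lambda> $ i $ j * \<nu> $ j))
        \<longlonglongrightarrow> (\<Sum>j\<in>UNIV. \<Lambda> $ i $ j * (\<nu> $ j - m $ j))"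
      by (simp add: sum_negf sum_subtractf right_diff_distrib)
    show "\<forall>\<^sub>F B in sequentially. (\<Sum>j\<in>UNIV. - \<Lambda> $ i $ j * smean B (\<lambda>k. t k $ j)) + (\<Sum>j\<in>UNIV. \<Lambda> $ i $ j * \<nu> $ j)
        = smean B (\<lambda>k. g (t k) $ i)"
      using B unfolding score by eventually_elim (simp only: smean_add smean_sum smean_cmult smean_const)
  qed
  \<comment> \<open>The second index \<open>l\<close> is kept free, because expanding one argument
    of the score covariance leaves cross terms with every coordinate. In the limit only
    \<open>j = l\<close> survives.\<close>
  have cross: "(\<lambda>B. scov B (\<lambda>k. g (t k) $ i) (\<lambda>k. t k $ l)) \<longlonglongrightarrow> - (S $ l $ l * \<Lambda> $ i $ l)" for i l
  proof (rule Lim_transform_eventually)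
    have "(\<lambda>B. \<Sum>j\<in>UNIV. - \<Lambda> $ i $ j * scov B (\<lambda>k. t k $ j) (\<lambda>k. t k $ l))
        \<longlonglongrightarrow> (\<Sum>j\<in>UNIV. - \<Lambda> $ i $ j * (if j = l then S $ j $ j else 0))"
      by (intro tendsto_intros cov)
    also have "(\<Sum>j\<in>UNIV. - \<Lambda> $ i $ j * (if j = l then S $ j $ j else 0))
        = (\<Sum>j\<in>UNIV. if j = l then - (S $ l $ l * \<Lambda> $ i $ l) else 0)"
      by (intro sum.cong) auto
    finally show "(\<lambda>B. \<Sum>j\<in>UNIV. - \<Lambda> $ i $ j * scov B (\<lambda>k. t k $ j) (\<lambda>k. t k $ l))
        \<longlonglongrightarrow> - (S $ l $ l * \<Lambda> $ i $ l)" by simp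
    show "\<forall>\<^sub>F B in sequentially. (\<Sum>j\<in>UNIV. - \<Lambda> $ i $ j * scov B (\<lambda>k. t k $ j) (\<lambda>k. t k $ l))
        = scov B (\<lambda>k. g (t k) $ i) (\<lambda>k. t k $ l)"
      using B unfolding score by eventually_elim (rule scov_sum_left[symmetric])
  qed
  show "(\<lambda>B. scov B (\<lambda>k. t k $ i) (\<lambda>k. g (t k) $ i)) \<longlonglongrightarrow> - (S $ i $ i * \<Lambda> $ i $ i)"
    using cross[of i i] by (simp only: scov_commute)
  show "(\<lambda>B. scov B (\<lambda>k. g (t k) $ i) (\<lambda>k. g (t k) $ i)) \<longlonglongrightarrow> (\<Sum>j\<in>UNIV. S $ j $ j * (\<Lambda> $ i $ j)\<^sup>2)"
  proof (rule Lim_transform_eventually)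
    have "(\<lambda>B. \<Sum>j\<in>UNIV. - \<Lambda> $ i $ j * scov B (\<lambda>k. t k $ j) (\<lambda>k. g (t k) $ i))
        \<longlonglongrightarrow> (\<Sum>j\<in>UNIV. - \<Lambda> $ i $ j * - (S $ j $ j * \<Lambda> $ i $ j))"
      unfolding scov_commute[of _ "\<lambda>k. t k $ _"] by (intro tendsto_intros cross)
    then show "(\<lambda>B. \<Sum>j\<in>UNIV. - \<Lambda> $ i $ j * scov B (\<lambda>k. t k $ j) (\<lambda>k. g (t k) $ i))
        \<longlonglongrightarrow> (\<Sum>j\<in>UNIV. S $ j $ j * (\<Lambda> $ i $ j)\<^sup>2)"
      by (simp add: power2_eq_square mult_ac)
    show "\<forall>\<^sub>F B in sequentially. (\<Sum>j\<in>UNIV. - \<Lambda> $ i $ j * scov B (\<lambda>k. t k $ j) (\<lambda>k. g (t k) $ i))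
        = scov B (\<lambda>k. g (t k) $ i) (\<lambda>k. g (t k) $ i)"
      using B
    proof eventually_elim
      case (elim B)
      show ?case
        using scov_sum_left[OF elim, of "\<lambda>j. - \<Lambda> $ i $ j" "\<lambda>j k. t k $ j" UNIV
            "\<Sum>j\<in>UNIV. \<Lambda> $ i $ j * \<nu> $ j" "\<lambda>k. g (t k) $ i"]
        unfolding score[symmetric] by (rule sym)
    qed
  qed
qed

section \<open>Existence, uniqueness and convergence of the minimizers\<close>

theorem theorem5:
  fixes M :: "'a measure"
    and \<theta> :: "nat \<Rightarrow> 'a \<Rightarrow> real^'n"
    and \<nu> \<mu>h :: "real^'n"
    and \<Lambda> \<Sigma>h :: "real^'n^'n"
    and g :: "real^'n \<Rightarrow> real^'n"
  assumes "prob_space M"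
    and "pos_definite \<Lambda>"
    and "pos_diagonal \<Sigma>h"
    and "prob_space.indep_vars M (\<lambda>_. borel) \<theta> UNIV"
    and "\<And>k. distributed M lborel (\<theta> k) (\<lambda>x. ennreal (mvn_density \<mu>h \<Sigma>h x))"
    and "g = score (mvn_density \<nu> (matrix_inv \<Lambda>))"
  shows
    "(AE \<omega> in M. \<forall>B>1. \<exists>!l. is_minimizer (batch_score_div g B (\<lambda>k. \<theta> k \<omega>)) l) \<and>
     (AE \<omega> in M. \<forall>\<^sub>F B in sequentially. \<exists>!l. is_minimizer (batch_fisher_div g B (\<lambda>k. \<theta> k \<omega>)) l) \<and>
     (\<forall>(\<mu>S :: nat \<Rightarrow> 'a \<Rightarrow> real^'n) (\<Sigma>S :: nat \<Rightarrow> 'a \<Rightarrow> real^'n^'n).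
        (AE \<omega> in M. \<forall>\<^sub>F B in sequentially.
            is_minimizer (batch_score_div g B (\<lambda>k. \<theta> k \<omega>)) (\<mu>S B \<omega>, \<Sigma>S B \<omega>)) \<longrightarrow>
        (\<forall>i.
          (AE \<omega> in M. (\<lambda>B. \<Sigma>S B \<omega> $ i $ i) \<longlonglongrightarrow>
             sqrt (\<Sigma>h $ i $ i / (\<Sum>j\<in>UNIV. \<Sigma>h $ j $ j * (\<Lambda> $ i $ j)\<^sup>2))) \<and>
          (AE \<omega> in M. (\<lambda>B. \<mu>S B \<omega> $ i) \<longlonglongrightarrow>
             \<mu>h $ i + sqrt (\<Sigma>h $ i $ i / (\<Sum>j\<in>UNIV. \<Sigma>h $ j $ j * (\<Lambda> $ i $ j)\<^sup>2))
                        * (\<Sum>j\<in>UNIV. \<Lambda> $ i $ j * (\<nu> $ j - \<mu>h $ j))))) \<and>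
     (\<forall>(\<mu>F :: nat \<Rightarrow> 'a \<Rightarrow> real^'n) (\<Sigma>F :: nat \<Rightarrow> 'a \<Rightarrow> real^'n^'n).
        (AE \<omega> in M. \<forall>\<^sub>F B in sequentially.
            is_minimizer (batch_fisher_div g B (\<lambda>k. \<theta> k \<omega>)) (\<mu>F B \<omega>, \<Sigma>F B \<omega>)) \<longrightarrow>
        (\<forall>i.
          (AE \<omega> in M. (\<lambda>B. \<Sigma>F B \<omega> $ i $ i) \<longlonglongrightarrow> 1 / \<Lambda> $ i $ i) \<and>
          (AE \<omega> in M. (\<lambda>B. \<mu>F B \<omega> $ i) \<longlonglongrightarrow>
             \<mu>h $ i + 1 / \<Lambda> $ i $ i * (\<Sum>j\<in>UNIV. \<Lambda> $ i $ j * (\<nu> $ j - \<mu>h $ j)))))"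
proof -
  interpret prob_space M by fact
  note indep = assms(4) and dist = assms(5)
  have g: "g x = - (\<Lambda> *v (x - \<nu>))" for x
    unfolding assms(6) by (rule score_mvn_density) fact
  have S_pos: "0 < \<Sigma>h $ i $ i" for i using assms(3) by (simp add: pos_diagonal_def)
  have L_pos: "0 < \<Lambda> $ i $ i" for i by (rule pos_definite_diag) fact
  have V_pos: "0 < (\<Sum>j\<in>UNIV. \<Sigma>h $ j $ j * (\<Lambda> $ i $ j)\<^sup>2)" for i
  proof (rule sum_pos2[of _ i])
    show "0 < \<Sigma>h $ i $ i * (\<Lambda> $ i $ i)\<^sup>2" using S_pos[of i] L_pos[of i] by simp
    show "0 \<le> \<Sigma>h $ j $ j * (\<Lambda> $ i $ j)\<^sup>2" for j using S_pos[of j] by simp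
  qed auto
  define x where "x \<omega> i k = \<theta> k \<omega> $ i" for \<omega> i k
  define y where "y \<omega> i k = g (\<theta> k \<omega>) $ i" for \<omega> i k
  define s where "s B \<omega> i = sqrt (scov B (x \<omega> i) (x \<omega> i) / scov B (y \<omega> i) (y \<omega> i))" for B \<omega> i
  define r where "r B \<omega> i = scov B (x \<omega> i) (x \<omega> i) / (- scov B (x \<omega> i) (y \<omega> i))" for B \<omega> i
  note xy = x_def[abs_def] y_def[abs_def]
  define c where "c i = (\<Sum>j\<in>UNIV. \<Lambda> $ i $ j * (\<nu> $ j - \<mu>h $ j))" for i
  define V where "V i = (\<Sum>j\<in>UNIV. \<Sigma>h $ j $ j * (\<Lambda> $ i $ j)\<^sup>2)" for i
  \<comment> \<open>The almost sure event on which all needed moments converge; the limits below are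
    deterministic for each fixed \<omega> in it.\<close>
  define good where "good \<omega> \<longleftrightarrow> (\<forall>i. (\<lambda>B. smean B (x \<omega> i)) \<longlonglongrightarrow> \<mu>h $ i \<and> (\<lambda>B. smean B (y \<omega> i)) \<longlonglongrightarrow> c i
      \<and> (\<lambda>B. scov B (x \<omega> i) (x \<omega> i)) \<longlonglongrightarrow> \<Sigma>h $ i $ i
      \<and> (\<lambda>B. scov B (x \<omega> i) (y \<omega> i)) \<longlonglongrightarrow> - (\<Sigma>h $ i $ i * \<Lambda> $ i $ i)
      \<and> (\<lambda>B. scov B (y \<omega> i) (y \<omega> i)) \<longlonglongrightarrow> V i)" for \<omega>
  have good: "AE \<omega> in M. good \<omega>"
    using AE_sample_mean[OF indep dist assms(3)] AE_sample_product[OF indep dist assms(3)]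
  proof eventually_elim
    case (elim \<omega>)
    then have "\<And>i. (\<lambda>B. smean B (\<lambda>k. \<theta> k \<omega> $ i - \<mu>h $ i)) \<longlonglongrightarrow> 0"
      "\<And>i j. (\<lambda>B. smean B (\<lambda>k. (\<theta> k \<omega> $ i - \<mu>h $ i) * (\<theta> k \<omega> $ j - \<mu>h $ j)))
        \<longlonglongrightarrow> (if i = j then \<Sigma>h $ i $ i else 0)"
      by blast+
    note lim = this g
    show ?case
      unfolding good_def xy c_def V_def
      by (intro allI conjI tendsto_smean_sample[OF lim] tendsto_smean_score[OF lim] tendsto_scov_sample[OF lim]
          tendsto_scov_sample_score[OF lim] tendsto_scov_score[OF lim])
  qed
  \<comment> \<open>An equivalence rather than mere existence: any selection of minimizers must then
    agree with the closed form, whatever its dependence on \<omega>.\<close>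
  have score_iff: "is_minimizer (batch_score_div g B (\<lambda>k. \<theta> k \<omega>)) l \<longleftrightarrow>
      l = (\<chi> i. smean B (x \<omega> i) + s B \<omega> i * smean B (y \<omega> i), \<chi> i j. if i = j then s B \<omega> i else 0)"
    if "0 < B" "\<And>i. 0 < scov B (x \<omega> i) (x \<omega> i)" "\<And>i. 0 < scov B (y \<omega> i) (y \<omega> i)" for B \<omega> l
    using is_minimizer_batch_score_div_iff[of B "\<lambda>k. \<theta> k \<omega>" g l] that unfolding xy s_def[abs_def] by simp
  have fisher_iff: "is_minimizer (batch_fisher_div g B (\<lambda>k. \<theta> k \<omega>)) l \<longleftrightarrow>
      l = (\<chi> i. smean B (x \<omega> i) + r B \<omega> i * smean B (y \<omega> i), \<chi> i j. if i = j then r B \<omega> i else 0)"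
    if "0 < B" "\<And>i. 0 < scov B (x \<omega> i) (x \<omega> i)" "\<And>i. scov B (x \<omega> i) (y \<omega> i) < 0" for B \<omega> l
    using is_minimizer_batch_fisher_div_iff[of B "\<lambda>k. \<theta> k \<omega>" g l] that unfolding xy r_def[abs_def] by simp
  \<comment> \<open>The limits of these covariances have strict signs, so the covariances themselves
    eventually have the same signs, simultaneously for the finitely many coordinates.\<close>
  have ev: "\<forall>\<^sub>F B in sequentially. 0 < B \<and> (\<forall>i. 0 < scov B (x \<omega> i) (x \<omega> i)) \<and>
      (\<forall>i. 0 < scov B (y \<omega> i) (y \<omega> i)) \<and> (\<forall>i. scov B (x \<omega> i) (y \<omega> i) < 0)" if "good \<omega>" for \<omega>
  proof (intro eventually_conj eventually_all_finite eventually_gt_at_top)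
    fix i
    note lims = that[unfolded good_def, THEN spec[of _ i]]
    show "\<forall>\<^sub>F B in sequentially. 0 < scov B (x \<omega> i) (x \<omega> i)"
      by (rule order_tendstoD(1)[OF _ S_pos[of i]]) (use lims in blast)
    show "\<forall>\<^sub>F B in sequentially. 0 < scov B (y \<omega> i) (y \<omega> i)"
      by (rule order_tendstoD(1)[OF _ V_pos[of i]]) (use lims V_def in simp)
    have "- (\<Sigma>h $ i $ i * \<Lambda> $ i $ i) < 0" using S_pos[of i] L_pos[of i] by simp
    from order_tendstoD(2)[OF _ this] lims
    show "\<forall>\<^sub>F B in sequentially. scov B (x \<omega> i) (y \<omega> i) < 0" by blast
  qed
  \<comment> \<open>Convergence would give positive variances only for large \<open>B\<close>.
    Almost sure distinctness of the first two samples gives them for every \<open>B > 1\<close> at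
    once.\<close>
  have neq: "AE \<omega> in M. \<forall>i. x \<omega> i 0 \<noteq> x \<omega> i 1 \<and> y \<omega> i 0 \<noteq> y \<omega> i 1"
  proof -
    have "AE \<omega> in M. x \<omega> i 0 \<noteq> x \<omega> i 1" for i
      using AE_sample_inner_neq[OF indep dist, of "axis i 1" 0 1]
      by (simp add: x_def inner_axis')
    moreover have "AE \<omega> in M. y \<omega> i 0 \<noteq> y \<omega> i 1" for i
    proof -
      \<comment> \<open>Coordinate \<open>i\<close> of the score is, up to sign and a constant, the
        inner product with row \<open>i\<close> of \<Lambda>, which is nonzero because its diagonal
        entry is positive.\<close>
      have "\<Lambda> $ i \<noteq> 0" using L_pos[of i] by (metis less_irrefl zero_index)
      from AE_sample_inner_neq[OF indep dist this, of 0 1]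
      show ?thesis
        by (simp add: y_def g matrix_vector_mul_component inner_diff_right)
    qed
    ultimately show ?thesis by (simp add: AE_all_countable)
  qed
  show ?thesis
  proof (intro conjI allI impI)
    show "AE \<omega> in M. \<forall>B>1. \<exists>!l. is_minimizer (batch_score_div g B (\<lambda>k. \<theta> k \<omega>)) l"
      using neq
    proof eventually_elim
      case (elim \<omega>)
      then show ?case by (auto simp: score_iff scov_self_pos)
    qed
    show "AE \<omega> in M. \<forall>\<^sub>F B in sequentially. \<exists>!l. is_minimizer (batch_fisher_div g B (\<lambda>k. \<theta> k \<omega>)) l"
      using good
    proof eventually_elim
      case (elim \<omega>)
      from ev[OF elim] show ?case by eventually_elim (simp add: fisher_iff)
    qed
  next
    fix \<mu>S :: "nat \<Rightarrow> 'a \<Rightarrow> real^'n" and \<Sigma>S :: "nat \<Rightarrow> 'a \<Rightarrow> real^'n^'n" and i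
    assume min: "AE \<omega> in M. \<forall>\<^sub>F B in sequentially.
      is_minimizer (batch_score_div g B (\<lambda>k. \<theta> k \<omega>)) (\<mu>S B \<omega>, \<Sigma>S B \<omega>)"
    have s_lim: "(\<lambda>B. s B \<omega> i) \<longlonglongrightarrow> sqrt (\<Sigma>h $ i $ i / V i)" if "good \<omega>" for \<omega>
      using that V_pos[of i] unfolding s_def good_def
      by (intro tendsto_real_sqrt tendsto_divide) (auto simp: V_def)
    have eq: "\<forall>\<^sub>F B in sequentially. \<Sigma>S B \<omega> $ i $ i = s B \<omega> i \<and>
        \<mu>S B \<omega> $ i = smean B (x \<omega> i) + s B \<omega> i * smean B (y \<omega> i)"
      if "good \<omega>" "\<forall>\<^sub>F B in sequentially. is_minimizer (batch_score_div g B (\<lambda>k. \<theta> k \<omega>)) (\<mu>S B \<omega>, \<Sigma>S B \<omega>)" for \<omega>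
      using ev[OF that(1)] that(2) by eventually_elim (simp add: score_iff)
    show "AE \<omega> in M. (\<lambda>B. \<Sigma>S B \<omega> $ i $ i) \<longlonglongrightarrow>
        sqrt (\<Sigma>h $ i $ i / (\<Sum>j\<in>UNIV. \<Sigma>h $ j $ j * (\<Lambda> $ i $ j)\<^sup>2))"
      using good min unfolding V_def[symmetric]
    proof eventually_elim
      case (elim \<omega>)
      from eq[OF elim] show ?case
        by (intro Lim_transform_eventually[OF s_lim[OF elim(1)]]) (auto elim: eventually_mono)
    qed
    show "AE \<omega> in M. (\<lambda>B. \<mu>S B \<omega> $ i) \<longlonglongrightarrow>
        \<mu>h $ i + sqrt (\<Sigma>h $ i $ i / (\<Sum>j\<in>UNIV. \<Sigma>h $ j $ j * (\<Lambda> $ i $ j)\<^sup>2))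
          * (\<Sum>j\<in>UNIV. \<Lambda> $ i $ j * (\<nu> $ j - \<mu>h $ j))"
      using good min unfolding V_def[symmetric] c_def[symmetric]
    proof eventually_elim
      case (elim \<omega>)
      have "(\<lambda>B. smean B (x \<omega> i) + s B \<omega> i * smean B (y \<omega> i)) \<longlonglongrightarrow> \<mu>h $ i + sqrt (\<Sigma>h $ i $ i / V i) * c i"
        using elim(1) unfolding good_def by (intro tendsto_add tendsto_mult s_lim[OF elim(1)]) auto
      then show ?case
        by (rule Lim_transform_eventually) (use eq[OF elim] in \<open>auto elim: eventually_mono\<close>)
    qed
  next
    fix \<mu>F :: "nat \<Rightarrow> 'a \<Rightarrow> real^'n" and \<Sigma>F :: "nat \<Rightarrow> 'a \<Rightarrow> real^'n^'n" and i
    assume min: "AE \<omega> in M. \<forall>\<^sub>F B in sequentially.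
      is_minimizer (batch_fisher_div g B (\<lambda>k. \<theta> k \<omega>)) (\<mu>F B \<omega>, \<Sigma>F B \<omega>)"
    have r_lim: "(\<lambda>B. r B \<omega> i) \<longlonglongrightarrow> 1 / \<Lambda> $ i $ i" if "good \<omega>" for \<omega>
    proof -
      have "(\<lambda>B. r B \<omega> i) \<longlonglongrightarrow> \<Sigma>h $ i $ i / - (- (\<Sigma>h $ i $ i * \<Lambda> $ i $ i))"
        using that S_pos[of i] L_pos[of i] unfolding r_def good_def
        by (intro tendsto_divide tendsto_minus) auto
      then show ?thesis using S_pos[of i] by simp
    qed
    have eq: "\<forall>\<^sub>F B in sequentially. \<Sigma>F B \<omega> $ i $ i = r B \<omega> i \<and>
        \<mu>F B \<omega> $ i = smean B (x \<omega> i) + r B \<omega> i * smean B (y \<omega> i)"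
      if "good \<omega>" "\<forall>\<^sub>F B in sequentially. is_minimizer (batch_fisher_div g B (\<lambda>k. \<theta> k \<omega>)) (\<mu>F B \<omega>, \<Sigma>F B \<omega>)" for \<omega>
      using ev[OF that(1)] that(2) by eventually_elim (simp add: fisher_iff)
    show "AE \<omega> in M. (\<lambda>B. \<Sigma>F B \<omega> $ i $ i) \<longlonglongrightarrow> 1 / \<Lambda> $ i $ i"
      using good min
    proof eventually_elim
      case (elim \<omega>)
      from eq[OF elim] show ?case
        by (intro Lim_transform_eventually[OF r_lim[OF elim(1)]]) (auto elim: eventually_mono)
    qed
    show "AE \<omega> in M. (\<lambda>B. \<mu>F B \<omega> $ i) \<longlonglongrightarrow>
        \<mu>h $ i + 1 / \<Lambda> $ i $ i * (\<Sum>j\<in>UNIV. \<Lambda> $ i $ j * (\<nu> $ j - \<mu>h $ j))"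
      using good min unfolding c_def[symmetric]
    proof eventually_elim
      case (elim \<omega>)
      have "(\<lambda>B. smean B (x \<omega> i) + r B \<omega> i * smean B (y \<omega> i)) \<longlonglongrightarrow> \<mu>h $ i + 1 / \<Lambda> $ i $ i * c i"
        using elim(1) unfolding good_def by (intro tendsto_add tendsto_mult r_lim[OF elim(1)]) auto
      then show ?case
        by (rule Lim_transform_eventually) (use eq[OF elim] in \<open>auto elim: eventually_mono\<close>)
    qed
  qed
qed

end
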